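(* Let $k\ge 1$ and $n$ be integers with $n\ge 4k^2+4k$. Let $\tau$ be an irreducible representation of $S_n$ whose Young diagram has at least $n-k$ boxes in the first row, and let $\sigma$ be an irreducible representation of $S_n$ whose Young diagram has at least $n-k$ boxes in the leftmost column. Then $\tau\succ\sigma$ in the Aldous order; that is, $\tau\ne\sigma$, and for every family $A=\{a_{i,j}\}_{1\le i<j\le n}$ of non-negative real numbers one has $\lambda_1(A;\tau)\le\lambda_1(A;\sigma)$.
   Context: Irreducible representations of the symmetric group $S_n$ are indexed by partitions $r_1\ge r_2\ge\dots\ge r_m>0$ of $n$ and denoted $[r_1,\dots,r_m]$ (the Specht module indexing, in which $[n]$ is the trivial representation and $[1^n]$ is the sign representation); the Young diagram of $[r_1,\dots,r_m]$ has $m$ left-justified rows, the $i$-th row from the top having $r_i$ boxes. All representations are finite dimensional and taken to be unitary. For a family $A=\{a_{i,j}\}_{1\le i<j\le n}$ of non-negative real numbers, let $\Delta_A=\sum_{i<j}a_{i,j}(\mathrm{id}-(ij))\in\mathbb{R}[S_n]$, where $(ij)$ is the transposition of $i$ and $j$. For a representation $\rho$ of $S_n$, $\rho(\Delta_A)=\sum_{i<j}a_{i,j}(\rho(\mathrm{id})-\rho((ij)))$ is positive semidefinite, and $\lambda_1(A;\rho)$ denotes its smallest eigenvalue. The Aldous order on irreducible representations of $S_n$ is defined by: $\rho\preceq\sigma$ if and only if $\lambda_1(A;\rho)\ge\lambda_1(A;\sigma)$ for all families $A$ of non-negative reals; $\rho\prec\sigma$ (equivalently $\sigma\succ\rho$)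 means $\rho\preceq\sigma$ and $\rho\neq\sigma$ (non-isomorphic). *)

theory Defs
  imports
    "HOL-Algebra.Sym_Groups"
    "Jordan_Normal_Form.Schur_Decomposition"
begin

text \<open>
  A representation of degree \<open>d\<close> is a group homomorphism from the symmetric group on \<open>{1..n}\<close> to
  \<open>GL d\<close> over the complex numbers. The degree is not a separate component: it is read off the
  matrix of the identity.
\<close>

type_synonym rep = "(nat \<Rightarrow> nat) \<Rightarrow> complex mat"

definition degree_rep :: "rep \<Rightarrow> nat" where
  "degree_rep \<rho> = dim_row (\<rho> id)"

definition GL :: "nat \<Rightarrow> complex mat monoid" where
  "GL d = units_of (ring_mat TYPE(complex) d ())"

definition representation :: "nat \<Rightarrow> rep \<Rightarrow> bool" where
  "representation n \<rho> \<longleftrightarrow> \<rho> \<in> hom (sym_group n) (GL (degree_rep \<rho>))"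

definition unitary_rep :: "nat \<Rightarrow> rep \<Rightarrow> bool" where
  "unitary_rep n \<rho> \<longleftrightarrow> representation n \<rho> \<and>
     (\<forall>p \<in> carrier (sym_group n). mat_adjoint (\<rho> p) * \<rho> p = 1\<^sub>m (degree_rep \<rho>))"

definition irreducible_rep :: "nat \<Rightarrow> rep \<Rightarrow> bool" where
  "irreducible_rep n \<rho> \<longleftrightarrow> representation n \<rho> \<and> degree_rep \<rho> > 0 \<and>
     (\<forall>W. VectorSpace.subspace class_ring W (module_vec TYPE(complex) (degree_rep \<rho>)) \<longrightarrow>
        (\<forall>p \<in> carrier (sym_group n). \<forall>w \<in> W. \<rho> p *\<^sub>v w \<in> W) \<longrightarrow>
        W = {0\<^sub>v (degree_rep \<rho>)} \<or> W = carrier_vec (degree_rep \<rho>))"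

definition isomorphic_rep :: "nat \<Rightarrow> rep \<Rightarrow> rep \<Rightarrow> bool" where
  "isomorphic_rep n \<rho> \<sigma> \<longleftrightarrow> degree_rep \<rho> = degree_rep \<sigma> \<and>
     (\<exists>P \<in> carrier (GL (degree_rep \<rho>)). \<forall>p \<in> carrier (sym_group n). P * \<rho> p = \<sigma> p * P)"

definition partition_of :: "nat \<Rightarrow> nat list \<Rightarrow> bool" where
  "partition_of n r \<longleftrightarrow> sorted_wrt (\<ge>) r \<and> (\<forall>x \<in> set r. x > 0) \<and> sum_list r = n"

text \<open>
  Rows and columns of a Young diagram are numbered from 0; a box is a pair (row, column).
\<close>

definition young_diagram :: "nat list \<Rightarrow> (nat \<times> nat) set" where
  "young_diagram r = {(i, j). i < length r \<and> j < r ! i}"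

definition first_row :: "nat list \<Rightarrow> (nat \<times> nat) set" where
  "first_row r = {b \<in> young_diagram r. fst b = 0}"

definition first_column :: "nat list \<Rightarrow> (nat \<times> nat) set" where
  "first_column r = {b \<in> young_diagram r. snd b = 0}"

text \<open>
  The Specht module of shape \<open>r\<close>. A tableau is a bijective filling of the boxes by \<open>{1..n}\<close>, and the
  tabloid of a tableau is the list of its row contents. The permutation module on the tabloids is
  modelled by complex functions of tabloids; the Specht module is the linear span in it of the
  polytabloids \<open>\<Sum>p \<in> C\<^sub>t. sign p \<cdot> {p t}\<close>, with \<open>C\<^sub>t\<close> the column stabilizer of \<open>t\<close>.
\<close>

type_synonym tabloid = "nat set list"

definition tableaux :: "nat \<Rightarrow> nat list \<Rightarrow> (nat \<times> nat \<Rightarrow> nat) set" where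
  "tableaux n r = {t \<in> extensional (young_diagram r). bij_betw t (young_diagram r) {1..n}}"

definition tabloid_of :: "nat list \<Rightarrow> (nat \<times> nat \<Rightarrow> nat) \<Rightarrow> tabloid" where
  "tabloid_of r t = map (\<lambda>i. t ` {b \<in> young_diagram r. fst b = i}) [0..<length r]"

definition column_stabilizer :: "nat \<Rightarrow> nat list \<Rightarrow> (nat \<times> nat \<Rightarrow> nat) \<Rightarrow> (nat \<Rightarrow> nat) set" where
  "column_stabilizer n r t = {p \<in> carrier (sym_group n).
     \<forall>j. p ` t ` {b \<in> young_diagram r. snd b = j} = t ` {b \<in> young_diagram r. snd b = j}}"

definition polytabloid :: "nat \<Rightarrow> nat list \<Rightarrow> (nat \<times> nat \<Rightarrow> nat) \<Rightarrow> tabloid \<Rightarrow> complex" where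
  "polytabloid n r t X = (\<Sum>p \<in> column_stabilizer n r t.
     of_int (sign p) * (if tabloid_of r (p \<circ> t) = X then 1 else 0))"

definition specht_module :: "nat \<Rightarrow> nat list \<Rightarrow> (tabloid \<Rightarrow> complex) set" where
  "specht_module n r = range (\<lambda>c X. \<Sum>t \<in> tableaux n r. c t * polytabloid n r t X)"

text \<open>Left action on functions of tabloids, which sends the indicator of \<open>X\<close> to that of \<open>p X\<close>.\<close>

definition tabloid_action :: "(nat \<Rightarrow> nat) \<Rightarrow> (tabloid \<Rightarrow> complex) \<Rightarrow> tabloid \<Rightarrow> complex" where
  "tabloid_action p f X = f (map ((`) (inv_into UNIV p)) X)"

text \<open>\<open>\<rho>\<close> is isomorphic to the Specht module of shape \<open>r\<close>, that is, \<open>\<rho> = [r\<^sub>1, \<dots>, r\<^sub>m]\<close>.\<close>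

definition has_young_diagram :: "nat \<Rightarrow> rep \<Rightarrow> nat list \<Rightarrow> bool" where
  "has_young_diagram n \<rho> r \<longleftrightarrow> representation n \<rho> \<and> partition_of n r \<and>
     (\<exists>T. bij_betw T (carrier_vec (degree_rep \<rho>)) (specht_module n r) \<and>
        (\<forall>v \<in> carrier_vec (degree_rep \<rho>). \<forall>w \<in> carrier_vec (degree_rep \<rho>).
           T (v + w) = (\<lambda>X. T v X + T w X)) \<and>
        (\<forall>c. \<forall>v \<in> carrier_vec (degree_rep \<rho>). T (c \<cdot>\<^sub>v v) = (\<lambda>X. c * T v X)) \<and>
        (\<forall>p \<in> carrier (sym_group n). \<forall>v \<in> carrier_vec (degree_rep \<rho>).
           T (\<rho> p *\<^sub>v v) = tabloid_action p (T v)))"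

text \<open>The matrix \<open>\<rho> \<Delta>\<^sub>A = (\<Sum>i<j. a\<^sub>i\<^sub>j (\<rho> id - \<rho> (i j)))\<close>, written entrywise.\<close>

definition laplacian :: "nat \<Rightarrow> (nat \<Rightarrow> nat \<Rightarrow> real) \<Rightarrow> rep \<Rightarrow> complex mat" where
  "laplacian n a \<rho> = mat (degree_rep \<rho>) (degree_rep \<rho>) (\<lambda>(k, l).
     \<Sum>(i, j) \<in> {(i, j). 1 \<le> i \<and> i < j \<and> j \<le> n}.
       complex_of_real (a i j) * ((\<rho> id - \<rho> (Transposition.transpose i j)) $$ (k, l)))"

definition lambda1 :: "nat \<Rightarrow> (nat \<Rightarrow> nat \<Rightarrow> real) \<Rightarrow> rep \<Rightarrow> real" where
  "lambda1 n a \<rho> = Min {x. eigenvalue (laplacian n a \<rho>) (complex_of_real x)}"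

definition aldous_le :: "nat \<Rightarrow> rep \<Rightarrow> rep \<Rightarrow> bool" where
  "aldous_le n \<rho> \<sigma> \<longleftrightarrow>
     (\<forall>a. (\<forall>i j. 1 \<le> i \<and> i < j \<and> j \<le> n \<longrightarrow> 0 \<le> a i j) \<longrightarrow> lambda1 n a \<rho> \<ge> lambda1 n a \<sigma>)"

definition aldous_less :: "nat \<Rightarrow> rep \<Rightarrow> rep \<Rightarrow> bool" where
  "aldous_less n \<rho> \<sigma> \<longleftrightarrow> aldous_le n \<rho> \<sigma> \<and> \<not> isomorphic_rep n \<rho> \<sigma>"

end

theory Submission
  imports Defs "Jordan_Normal_Form.Spectral_Radius"
begin

text \<open>
  An eigenvector for \<open>\<lambda>\<^sub>1(A; \<sigma>)\<close>, paired with the translates of a polytabloid of its shape, becomes a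
  function \<open>g\<close> on \<open>S\<^sub>n\<close> that changes sign under right multiplication by transpositions of the labels
  \<open>Y\<close> of the first column. If both ends of an edge lie in \<open>p ` Y\<close>, then the edge contributes
  \<open>2 |g p|\<^sup>2\<close> at \<open>p\<close> to the energy of \<open>g\<close>. Read \<open>|g|\<^sup>2\<close> as a law of a random set
  \<open>p ` (S - Y)\<close> of at most \<open>k\<close> points, and let \<open>V\<close> be the complement of the \<open>4k\<close> points that are
  covered most often. As \<open>|V| \<ge> 4k\<^sup>2\<close>, every edge has energy at least \<open>4k/|V|\<close> times the total mass
  of \<open>|g|\<^sup>2\<close> if it is contained in \<open>V\<close>, and at least \<open>k/|V|\<close> times that mass if it meets \<open>V\<close>.

  On the other side, a polytabloid of \<open>\<tau>\<close> all of whose columns of length at least 2 are filled from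
  \<open>V\<close> is invariant under the edges outside \<open>V\<close>. By the Garnir relation the transposition of an entry
  of a column of length \<open>c\<close> with an entry of a column of length 1 has energy \<open>1 - 1/c\<close>, and these
  numbers add up to the number of boxes below the first row. Averaging the Rayleigh quotient over all
  such polytabloids gives the same edge weights as upper bounds.
\<close>

section \<open>Self-adjoint matrices\<close>

definition selfadjoint_mat :: "nat \<Rightarrow> complex mat \<Rightarrow> bool" where
  "selfadjoint_mat d A \<longleftrightarrow> A \<in> carrier_mat d d \<and>
     (\<forall>v \<in> carrier_vec d. \<forall>w \<in> carrier_vec d. (A *\<^sub>v v) \<bullet>c w = v \<bullet>c (A *\<^sub>v w))"

definition sqnorm :: "complex vec \<Rightarrow> real" where
  "sqnorm v = Re (v \<bullet>c v)"

lemma inner_diff_left: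
  assumes "u \<in> carrier_vec d" "v \<in> carrier_vec d" "w \<in> carrier_vec d"
  shows "(u - v) \<bullet>c w = u \<bullet>c w - v \<bullet>c (w :: complex vec)"
  using assms by (simp add: minus_scalar_prod_distrib)

lemma inner_diff_right:
  assumes "u \<in> carrier_vec d" "v \<in> carrier_vec d" "w \<in> carrier_vec d"
  shows "w \<bullet>c (u - v) = w \<bullet>c u - w \<bullet>c (v :: complex vec)"
  using assms by (auto simp: scalar_prod_def sum_subtractf algebra_simps)

lemma inner_commute:
  assumes "u \<in> carrier_vec d" "v \<in> carrier_vec d"
  shows "v \<bullet>c u = cnj (u \<bullet>c (v :: complex vec))"
  using assms by (auto simp: scalar_prod_def mult.commute)

lemma sqnorm_eq_sum: "sqnorm v = (\<Sum>i<dim_vec v. (cmod (v $ i))\<^sup>2)"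
  by (simp add: sqnorm_def scalar_prod_def lessThan_atLeast0 complex_mult_cnj cmod_power2)

lemma sqnorm_nonneg: "sqnorm v \<ge> 0"
  by (simp add: sqnorm_eq_sum sum_nonneg)

lemma sqnorm_pos: "v \<in> carrier_vec d \<Longrightarrow> v \<noteq> 0\<^sub>v d \<Longrightarrow> sqnorm v > 0"
  by (metis conjugate_square_greater_0_vec less_complex_def sqnorm_def zero_complex.simps(1))

lemma inner_self: "v \<bullet>c v = complex_of_real (sqnorm v)"
  by (simp add: sqnorm_def scalar_prod_def complex_eq_iff)

lemma sqnorm_diff:
  assumes "u \<in> carrier_vec d" "v \<in> carrier_vec d"
  shows "sqnorm (u - v) = sqnorm u + sqnorm v - 2 * Re (u \<bullet>c v)"
proof -
  have "(u - v) \<bullet>c (u - v) = u \<bullet>c u - v \<bullet>c u - (u \<bullet>c v - v \<bullet>c v)"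
    using assms by (simp add: inner_diff_left[of _ d] inner_diff_right[of _ d])
  then show ?thesis using inner_commute[OF assms] by (simp add: sqnorm_def)
qed

section \<open>Rayleigh bound from bounded matrix powers\<close>

lemma smult_mat_mult_vec:
  assumes "A \<in> carrier_mat nr nc" "v \<in> carrier_vec nc"
  shows "(a \<cdot>\<^sub>m A) *\<^sub>v v = a \<cdot>\<^sub>v (A *\<^sub>v (v :: 'a :: comm_semiring_0 vec))"
  using assms by (intro eq_vecI) (auto simp: scalar_prod_def sum_distrib_left mult.assoc)

lemma pow_mat_Suc_left:
  assumes "A \<in> carrier_mat d d"
  shows "A * A ^\<^sub>m k = A ^\<^sub>m Suc k"
proof (induction k)
  case (Suc k)
  have "A * A ^\<^sub>m Suc k = (A * A ^\<^sub>m k) * A"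
    using assms by (simp add: assoc_mult_mat[of A d d _ d A d])
  then show ?case using Suc by simp
qed (use assms in auto)

text \<open>The increments of \<open>b\<close> never decrease, so a positive first increment would
  give linear growth and exceed \<open>C\<close>.\<close>

lemma bounded_convex_seq_le:
  fixes b :: "nat \<Rightarrow> real"
  assumes conv: "\<And>k. 2 * b (Suc k) \<le> b k + b (Suc (Suc k))" and bd: "\<And>k. b k \<le> C"
  shows "b 1 \<le> b 0"
proof (rule ccontr)
  define e where "e = b 1 - b 0"
  assume "\<not> b 1 \<le> b 0"
  then have e: "e > 0" by (simp add: e_def)
  have step: "b (Suc k) - b k \<ge> e" for k
    by (induction k) (use conv in \<open>force simp: e_def\<close>, use conv in \<open>smt (verit)\<close>)
  have lin: "b k \<ge> b 0 + k * e" for k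
  proof (induction k)
    case (Suc k)
    then show ?case using step[of k] by (simp add: algebra_simps)
  qed simp
  obtain k :: nat where "k * e > C - b 0" using e reals_Archimedean3 by blast
  then show False using lin[of k] bd[of k] by simp
qed

text \<open>A crude bound suffices: it serves to bound all iterates of a matrix with bounded powers
  by one constant.\<close>

lemma sqnorm_mult_le:
  assumes A: "A \<in> carrier_mat d d" and nb: "norm_bound A c" and v: "v \<in> carrier_vec d"
  shows "sqnorm (A *\<^sub>v v) \<le> d * (c * (\<Sum>j<d. cmod (v $ j)))\<^sup>2"
proof -
  have "cmod ((A *\<^sub>v v) $ i) \<le> c * (\<Sum>j<d. cmod (v $ j))" if "i < d" for i
  proof -
    have "(A *\<^sub>v v) $ i = (\<Sum>j<d. A $$ (i,j) * v $ j)"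
      using that A v by (auto simp: scalar_prod_def lessThan_atLeast0)
    also have "cmod \<dots> \<le> (\<Sum>j<d. cmod (A $$ (i,j)) * cmod (v $ j))"
      by (intro order_trans[OF norm_sum]) (simp add: norm_mult)
    also have "\<dots> \<le> (\<Sum>j<d. c * cmod (v $ j))"
      using nb A that by (intro sum_mono mult_right_mono) (auto simp: norm_bound_def)
    finally show ?thesis by (simp add: sum_distrib_left)
  qed
  then have "(\<Sum>i<d. (cmod ((A *\<^sub>v v) $ i))\<^sup>2) \<le> (\<Sum>i<d. (c * (\<Sum>j<d. cmod (v $ j)))\<^sup>2)"
    by (intro sum_mono power_mono) auto
  then show ?thesis using A by (simp add: sqnorm_eq_sum)
qed

lemma selfadjoint_contraction:
  assumes M: "selfadjoint_mat d M" and bd: "\<And>k. norm_bound (M ^\<^sub>m k) c" and v: "v \<in> carrier_vec d"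
  shows "Re ((M *\<^sub>v v) \<bullet>c v) \<le> sqnorm v"
proof -
  have MC: "M \<in> carrier_mat d d" using M by (simp add: selfadjoint_mat_def)
  define u where "u k = ((\<lambda>w. M *\<^sub>v w) ^^ k) v" for k
  have u: "u k \<in> carrier_vec d" for k
    by (induction k) (use v MC in \<open>auto simp: u_def\<close>)
  have up: "u k = M ^\<^sub>m k *\<^sub>v v" for k
  proof (induction k)
    case (Suc k)
    have "u (Suc k) = M *\<^sub>v (M ^\<^sub>m k *\<^sub>v v)" using Suc by (simp add: u_def)
    also have "\<dots> = (M * M ^\<^sub>m k) *\<^sub>v v" using MC v by (simp add: assoc_mult_mat_vec[of _ d d _ d])
    also have "M * M ^\<^sub>m k = M ^\<^sub>m Suc k" by (rule pow_mat_Suc_left[OF MC])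
    finally show ?case .
  qed (use v MC in \<open>auto simp: u_def\<close>)
  define b where "b k = sqnorm (u k)" for k
  text \<open>The squared norms \<open>b k\<close> form a bounded convex sequence, hence a decreasing one.\<close>
  have "2 * b (Suc k) \<le> b k + b (Suc (Suc k))" for k
  proof -
    have "u (Suc k) \<bullet>c u (Suc k) = u k \<bullet>c u (Suc (Suc k))"
      using M u[of k] u[of "Suc k"] by (auto simp: selfadjoint_mat_def u_def)
    then have "b (Suc k) = Re (u k \<bullet>c u (Suc (Suc k)))" by (simp add: b_def sqnorm_def)
    then show ?thesis
      using sqnorm_diff[OF u u, of k "Suc (Suc k)"] sqnorm_nonneg[of "u k - u (Suc (Suc k))"]
      by (simp add: b_def)
  qed
  moreover have "b k \<le> d * (c * (\<Sum>j<d. cmod (v $ j)))\<^sup>2" for k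
    unfolding b_def up by (rule sqnorm_mult_le) (use MC bd v in auto)
  ultimately have "b 1 \<le> b 0" by (rule bounded_convex_seq_le)
  then have "sqnorm (M *\<^sub>v v) \<le> sqnorm v" by (simp add: b_def u_def)
  moreover have "M *\<^sub>v v \<in> carrier_vec d" using MC v by auto
  \<comment> \<open>Expanding |Mv - v|^2 >= 0 gives 2 Re <Mv, v> <= |Mv|^2 + |v|^2, which is at most
    2 |v|^2.\<close>
  ultimately show ?thesis using sqnorm_diff[of "M *\<^sub>v v" d v] v sqnorm_nonneg[of "M *\<^sub>v v - v"] by auto
qed

lemma selfadjoint_eigenvalue_real:
  assumes A: "selfadjoint_mat d A" and e: "eigenvalue A e"
  shows "e = complex_of_real (Re e)"
proof -
  have AC: "A \<in> carrier_mat d d" using A by (simp add: selfadjoint_mat_def)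
  obtain v where v: "v \<in> carrier_vec d" "v \<noteq> 0\<^sub>v d" "A *\<^sub>v v = e \<cdot>\<^sub>v v"
    using e AC by (auto simp: eigenvalue_def eigenvector_def)
  have "(A *\<^sub>v v) \<bullet>c v = v \<bullet>c (A *\<^sub>v v)" using A v by (auto simp: selfadjoint_mat_def)
  then have "e * (v \<bullet>c v) = cnj e * (v \<bullet>c v)"
    using v by (simp add: conjugate_smult_vec)
  then have "e = cnj e" using v by simp
  then show ?thesis by (simp add: complex_eq_iff)
qed

text \<open>No diagonalization is used. The eigenvalues of \<open>A\<close> lie between
  \<open>\<mu>\<close> and some \<open>c\<close>, so for \<open>y > c - \<mu>\<close> the matrix
  \<open>(c - A) / y\<close> has spectral radius below 1. Its powers are therefore bounded and
  \<open>selfadjoint_contraction\<close> applies; letting \<open>y\<close> tend to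
  \<open>c - \<mu>\<close> gives the claim.\<close>

lemma selfadjoint_rayleigh:
  assumes A: "selfadjoint_mat d A" and v: "v \<in> carrier_vec d"
    and low: "\<And>x. eigenvalue A (complex_of_real x) \<Longrightarrow> \<mu> \<le> x"
  shows "\<mu> * sqnorm v \<le> Re ((A *\<^sub>v v) \<bullet>c v)"
proof (cases "d = 0")
  case True
  then show ?thesis using v A by (auto simp: sqnorm_def scalar_prod_def)
next
  case False
  have AC: "A \<in> carrier_mat d d" using A by (simp add: selfadjoint_mat_def)
  \<comment> \<open>Inserting \<open>\<mu>\<close> ensures \<open>\<mu> \<le> c\<close>, so that
    every \<open>y > c - \<mu>\<close> is positive.\<close>
  define c where "c = Max ((\<lambda>e. Re e) ` spectrum A \<union> {\<mu>})"
  have finA: "finite (spectrum A)" using card_finite_spectrum[OF AC] by simp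
  have c: "Re e \<le> c" if "eigenvalue A e" for e
    unfolding c_def using finA that by (intro Max_ge) (auto simp: spectrum_def)
  have c\<mu>: "\<mu> \<le> c" unfolding c_def using finA by (intro Max_ge) auto
  have key: "c * sqnorm v - Re ((A *\<^sub>v v) \<bullet>c v) \<le> y * sqnorm v" if y: "y > c - \<mu>" for y
  proof -
    have y0: "y > 0" using y c\<mu> by simp
    define M where "M = complex_of_real (1/y) \<cdot>\<^sub>m (complex_of_real c \<cdot>\<^sub>m 1\<^sub>m d - A)"
    have MC: "M \<in> carrier_mat d d" using AC by (auto simp: M_def)
    have Mv: "M *\<^sub>v w = complex_of_real (1/y) \<cdot>\<^sub>v (complex_of_real c \<cdot>\<^sub>v w - A *\<^sub>v w)" if "w \<in> carrier_vec d" for w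
    proof -
      have "(complex_of_real c \<cdot>\<^sub>m 1\<^sub>m d - A) *\<^sub>v w = complex_of_real c \<cdot>\<^sub>v w - A *\<^sub>v w"
        using AC that by (simp add: minus_mult_distrib_mat_vec[of _ d d] smult_mat_mult_vec[of _ d d])
      moreover have "complex_of_real c \<cdot>\<^sub>m 1\<^sub>m d - A \<in> carrier_mat d d" by (rule minus_carrier_mat[OF AC])
      ultimately show ?thesis using that unfolding M_def by (simp only: smult_mat_mult_vec)
    qed
    have inner: "(M *\<^sub>v w) \<bullet>c z = complex_of_real (1/y) * (complex_of_real c * (w \<bullet>c z) - (A *\<^sub>v w) \<bullet>c z)"
      "z \<bullet>c (M *\<^sub>v w) = complex_of_real (1/y) * (complex_of_real c * (z \<bullet>c w) - z \<bullet>c (A *\<^sub>v w))"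
      if "w \<in> carrier_vec d" "z \<in> carrier_vec d" for w z
      using that AC
      by (simp_all add: Mv conjugate_smult_vec inner_diff_left[of _ d] inner_diff_right[of _ d])
    have Ms: "selfadjoint_mat d M"
      using A MC by (simp add: selfadjoint_mat_def inner)
    have ev: "cmod e < 1" if e: "e \<in> spectrum M" for e
    proof -
      obtain w where w: "w \<in> carrier_vec d" "w \<noteq> 0\<^sub>v d" "M *\<^sub>v w = e \<cdot>\<^sub>v w"
        using e MC by (auto simp: spectrum_def eigenvalue_def eigenvector_def)
      \<comment> \<open>The eigenvalue of \<open>A\<close> belonging to the eigenvalue
        \<open>e\<close> of \<open>M\<close>, from \<open>e = (c - l) / y\<close>.\<close>
      define l where "l = complex_of_real c - complex_of_real y * e"
      have "complex_of_real (1/y) \<cdot>\<^sub>v (complex_of_real c \<cdot>\<^sub>v w - A *\<^sub>v w) = e \<cdot>\<^sub>v w"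
        using Mv w by simp
      then have "A *\<^sub>v w = l \<cdot>\<^sub>v w"
      proof (intro eq_vecI, goal_cases)
        case (1 i)
        then have i: "i < d" using w by simp
        have "(complex_of_real (1/y) \<cdot>\<^sub>v (complex_of_real c \<cdot>\<^sub>v w - A *\<^sub>v w)) $ i = (e \<cdot>\<^sub>v w) $ i" using 1 by simp
        then have "complex_of_real (1/y) * (complex_of_real c * w $ i - (A *\<^sub>v w) $ i) = e * w $ i"
          using i w AC by simp
        then show ?case using i w y0 by (simp add: l_def field_simps)
      qed (use AC w in auto)
      then have lev: "eigenvalue A l" using w AC by (auto simp: eigenvalue_def eigenvector_def)
      have lr: "l = complex_of_real (Re l)" by (rule selfadjoint_eigenvalue_real[OF A lev])
      have "\<mu> \<le> Re l" using low lev lr by metis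
      moreover have "Re l \<le> c" using c lev by simp
      moreover have "e = complex_of_real ((c - Re l) / y)"
        using lr y0 by (simp add: l_def field_simps complex_eq_iff)
      then have "cmod e = \<bar>(c - Re l) / y\<bar>" by (metis norm_of_real)
      ultimately show ?thesis using y y0 by simp
    qed
    have "spectral_radius M < 1"
      using ev spectral_radius_mem_max(1)[OF MC] False by auto
    then obtain b where b: "\<And>k. norm_bound (M ^\<^sub>m k) b"
      using spectral_radius_jnf_norm_bound_less_1_upper_triangular[OF MC] by blast
    have "Re ((M *\<^sub>v v) \<bullet>c v) \<le> sqnorm v" by (rule selfadjoint_contraction[OF Ms b v])
    then show ?thesis using y0 inner(1)[OF v v] inner_self[of v]
      by (simp add: field_simps)
  qed
  show ?thesis
  proof (rule field_le_epsilon)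
    fix e :: real assume e: "e > 0"
    \<comment> \<open>The summand 1 keeps the denominator positive for the zero vector too, and the
      resulting error is at most \<open>e\<close>.\<close>
    define y where "y = c - \<mu> + e / (sqnorm v + 1)"
    have "y > c - \<mu>" using e sqnorm_nonneg[of v] by (simp add: y_def add_nonneg_pos)
    from key[OF this] have "\<mu> * sqnorm v \<le> Re ((A *\<^sub>v v) \<bullet>c v) + e * (sqnorm v / (sqnorm v + 1))"
      by (simp add: y_def algebra_simps)
    also have "e * (sqnorm v / (sqnorm v + 1)) \<le> e * 1"
      using e sqnorm_nonneg[of v] by (intro mult_left_mono) auto
    finally show "\<mu> * sqnorm v \<le> Re ((A *\<^sub>v v) \<bullet>c v) + e" by simp
  qed
qed

section \<open>Functions on a symmetric group that alternate on a large set\<close>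

text \<open>Greedy choice: each step adds a maximizer of \<open>f\<close> outside the set built so
  far.\<close>

lemma ex_top_subset:
  fixes f :: "'a \<Rightarrow> 'b :: linorder"
  assumes "finite A" "m \<le> card A"
  obtains B where "B \<subseteq> A" "card B = m" "\<And>x y. x \<in> A - B \<Longrightarrow> y \<in> B \<Longrightarrow> f x \<le> f y"
proof -
  have "\<exists>B \<subseteq> A. card B = m \<and> (\<forall>x \<in> A - B. \<forall>y \<in> B. f x \<le> f y)"
    using assms(2)
  proof (induction m)
    case 0
    then show ?case by (intro exI[of _ "{}"]) auto
  next
    case (Suc m)
    then obtain B where B: "B \<subseteq> A" "card B = m" "\<forall>x \<in> A - B. \<forall>y \<in> B. f x \<le> f y" by auto
    have "finite B" using B(1) assms(1) finite_subset by blast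
    have ne: "f ` (A - B) \<noteq> {}" "finite (f ` (A - B))"
      using B Suc.prems assms(1) by (auto simp: not_less_eq_eq[symmetric])
    then have "Max (f ` (A - B)) \<in> f ` (A - B)" by (rule Max_in[rotated])
    then obtain z where z: "z \<in> A - B" "f z = Max (f ` (A - B))" by (metis imageE)
    have "f x \<le> f z" if "x \<in> A - B" for x using that ne z by simp
    then show ?case using B z \<open>finite B\<close> by (intro exI[of _ "insert z B"]) auto
  qed
  then show ?thesis using that by blast
qed

lemma permutes_transpose_comp:
  assumes "i \<in> S" "j \<in> S" "p permutes S"
  shows "transpose i j \<circ> p permutes S"
  using assms by (simp add: permutes_compose permutes_swap_id)

lemma sum_permutes_transpose_comp:
  assumes "i \<in> S" "j \<in> S"
  shows "(\<Sum>p | p permutes S. f (transpose i j \<circ> p)) = (\<Sum>p | p permutes S. f p)"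
  by (rule sum.reindex_bij_witness[of _ "\<lambda>p. transpose i j \<circ> p" "\<lambda>p. transpose i j \<circ> p"])
    (use assms in \<open>auto simp: permutes_transpose_comp comp_assoc[symmetric]\<close>)

text \<open>From |x|^2 <= 2 |x - y|^2 + 2 |y|^2. It serves the pairs \<open>p\<close>,
  \<open>transpose i j \<circ> p\<close> whose values under \<open>g\<close> are not tied by a sign
  rule.\<close>

lemma norm_diff_ge_half:
  "(norm (x - y))\<^sup>2 \<ge> (norm x)\<^sup>2 / 2 - (norm (y :: 'a :: real_normed_vector))\<^sup>2"
proof -
  have "(norm x)\<^sup>2 \<le> (norm (x - y) + norm y)\<^sup>2"
    by (intro power_mono) (use norm_triangle_ineq[of "x - y" y] in auto)
  also have "\<dots> \<le> 2 * (norm (x - y))\<^sup>2 + 2 * (norm y)\<^sup>2"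
    using zero_le_power2[of "norm (x - y) - norm y"] by (simp add: power2_eq_square algebra_simps)
  finally show ?thesis by simp
qed

section \<open>Alternating functions and lower bounds for their Dirichlet forms\<close>

text \<open>The sign rule concerns right multiplication, which commutes with the left
  multiplications in \<open>dirichlet\<close>.\<close>

definition alternating_on :: "'a set \<Rightarrow> 'a set \<Rightarrow> (('a \<Rightarrow> 'a) \<Rightarrow> complex) \<Rightarrow> bool" where
  "alternating_on S Y g \<longleftrightarrow> Y \<subseteq> S \<and>
     (\<forall>p y z. p permutes S \<longrightarrow> y \<in> Y \<longrightarrow> z \<in> Y \<longrightarrow> y \<noteq> z \<longrightarrow> g (p \<circ> transpose y z) = - g p)"

text \<open>The quadratic form of \<open>id - (i j)\<close> in the left regular representation. The
  factor 1/2 is there because each pair \<open>p\<close>, \<open>transpose i j \<circ> p\<close> is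
  counted twice.\<close>

definition dirichlet :: "'a set \<Rightarrow> (('a \<Rightarrow> 'a) \<Rightarrow> complex) \<Rightarrow> 'a \<Rightarrow> 'a \<Rightarrow> real" where
  "dirichlet S g i j = (\<Sum>p | p permutes S. (cmod (g p - g (transpose i j \<circ> p)))\<^sup>2) / 2"

text \<open>Left multiplication by a transposition of two points in the image of \<open>Y\<close> is
  right multiplication by the transposition of their preimages.\<close>

lemma alternating_on_transpose_comp:
  assumes "alternating_on S Y g" "p permutes S" "i \<in> p ` Y" "j \<in> p ` Y" "i \<noteq> j"
  shows "g (transpose i j \<circ> p) = - g p"
proof -
  obtain y z where yz: "y \<in> Y" "z \<in> Y" "i = p y" "j = p z" using assms by auto
  have "transpose (p y) (p z) \<circ> p = p \<circ> transpose y z"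
    using permutes_inj[OF assms(2)] by (auto simp: transpose_def inj_eq fun_eq_iff)
  then show ?thesis using assms yz unfolding alternating_on_def by auto
qed

locale alternating_function =
  fixes S Y :: "'a set" and g :: "('a \<Rightarrow> 'a) \<Rightarrow> complex" and k :: nat
  assumes finS: "finite S" and alt: "alternating_on S Y g" and cardY: "card (S - Y) \<le> k"
begin

abbreviation w :: "('a \<Rightarrow> 'a) \<Rightarrow> real" where "w p \<equiv> (cmod (g p))\<^sup>2"

definition mass :: real where "mass = (\<Sum>p | p permutes S. w p)"

text \<open>For \<open>i\<close> in \<open>S\<close> this is the mass of the permutations
  \<open>p\<close> that have \<open>i\<close> in the exceptional set, the image of
  \<open>S - Y\<close> under \<open>p\<close>.\<close>

definition occ :: "'a \<Rightarrow> real" where "occ i = (\<Sum>p | p permutes S. if i \<in> p ` Y then 0 else w p)"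

definition none :: "'a \<Rightarrow> 'a \<Rightarrow> real" where
  "none i j = (\<Sum>p | p permutes S. if i \<in> p ` Y \<and> j \<in> p ` Y then w p else 0)"

lemma finP: "finite {p. p permutes S}" using finS by (rule finite_permutations)

lemma mass_nonneg: "mass \<ge> 0" by (simp add: mass_def sum_nonneg)
lemma occ_nonneg: "occ i \<ge> 0" by (simp add: occ_def sum_nonneg)
lemma none_nonneg: "none i j \<ge> 0" by (auto simp: none_def intro!: sum_nonneg)

text \<open>Double counting: an exceptional set has at most \<open>k\<close> elements.\<close>

lemma sum_occ: "(\<Sum>i\<in>S. occ i) \<le> k * mass"
proof -
  have "(\<Sum>i\<in>S. occ i) = (\<Sum>p | p permutes S. \<Sum>i\<in>S. if i \<in> p ` Y then 0 else w p)"
    unfolding occ_def by (rule sum.swap)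
  also have "\<dots> \<le> (\<Sum>p | p permutes S. k * w p)"
  proof (rule sum_mono)
    fix p assume "p \<in> {p. p permutes S}"
    then have p: "p permutes S" by simp
    have "S - p ` Y = p ` (S - Y)"
      using permutes_image[OF p] permutes_inj[OF p] by (auto simp: inj_eq)
    then have "card (S - p ` Y) \<le> k"
      using cardY card_image_le[of "S - Y" p] finS by (simp add: order_trans)
    moreover have "(\<Sum>i\<in>S. if i \<in> p ` Y then 0 else w p) = (\<Sum>i\<in>S - p ` Y. w p)"
      using finS by (intro sum.mono_neutral_cong_right) auto
    ultimately show "(\<Sum>i\<in>S. if i \<in> p ` Y then 0 else w p) \<le> k * w p"
      by (simp add: mult_right_mono)
  qed
  finally show ?thesis by (simp add: mass_def sum_distrib_left)
qed

text \<open>The union bound for the events that \<open>i\<close> or \<open>j\<close> is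
  exceptional.\<close>

lemma none_ge: "none i j \<ge> mass - occ i - occ j"
proof -
  have "mass - occ i - occ j =
      (\<Sum>p | p permutes S. w p - (if i \<in> p ` Y then 0 else w p) - (if j \<in> p ` Y then 0 else w p))"
    by (simp add: mass_def occ_def sum_subtractf)
  also have "\<dots> \<le> none i j" unfolding none_def by (intro sum_mono) auto
  finally show ?thesis .
qed

lemma image_transpose_comp:
  assumes "i \<noteq> j"
  shows "i \<in> (transpose i j \<circ> p) ` Y \<longleftrightarrow> j \<in> p ` Y" "j \<in> (transpose i j \<circ> p) ` Y \<longleftrightarrow> i \<in> p ` Y"
  using assms by (auto simp: transpose_def image_iff split: if_splits)

text \<open>Pairing \<open>p\<close> with \<open>transpose i j \<circ> p\<close> allows a lower
  bound for the squared difference to be charged unevenly to the two members of the pair.\<close>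

lemma dirichlet_ge_sum:
  assumes ij: "i \<in> S" "j \<in> S" "i \<noteq> j"
    and le: "\<And>p. p permutes S \<Longrightarrow> h p + h (transpose i j \<circ> p) \<le> (cmod (g p - g (transpose i j \<circ> p)))\<^sup>2"
  shows "(\<Sum>p | p permutes S. h p) \<le> dirichlet S g i j"
proof -
  have "2 * (\<Sum>p | p permutes S. h p) = (\<Sum>p | p permutes S. h p + h (transpose i j \<circ> p))"
    using sum_permutes_transpose_comp[OF ij(1,2), of h] by (simp add: sum.distrib)
  also have "\<dots> \<le> (\<Sum>p | p permutes S. (cmod (g p - g (transpose i j \<circ> p)))\<^sup>2)"
    using le by (intro sum_mono) auto
  finally show ?thesis by (simp add: dirichlet_def)
qed

lemma cmod_diff_transpose:
  assumes "p permutes S" "i \<in> p ` Y" "j \<in> p ` Y" "i \<noteq> j"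
  shows "(cmod (g p - g (transpose i j \<circ> p)))\<^sup>2 = 4 * w p" "w (transpose i j \<circ> p) = w p"
proof -
  have "g p - g (transpose i j \<circ> p) = 2 * g p"
    using alternating_on_transpose_comp[OF alt assms] by simp
  then show "(cmod (g p - g (transpose i j \<circ> p)))\<^sup>2 = 4 * w p"
    by (simp only: norm_mult power_mult_distrib) simp
qed (use alternating_on_transpose_comp[OF alt assms] in simp)

text \<open>If both ends lie in the image of \<open>Y\<close>, the two values of \<open>g\<close>
  are opposite and each member of the pair is charged half of \<open>4 * w p\<close>.\<close>

lemma dirichlet_ge_none:
  assumes ij: "i \<in> S" "j \<in> S" "i \<noteq> j"
  shows "2 * none i j \<le> dirichlet S g i j"
proof -
  define h where "h p = (if i \<in> p ` Y \<and> j \<in> p ` Y then 2 * w p else 0)" for p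
  have "(\<Sum>p | p permutes S. h p) \<le> dirichlet S g i j"
  proof (rule dirichlet_ge_sum[OF ij])
    fix p assume p: "p permutes S"
    show "h p + h (transpose i j \<circ> p) \<le> (cmod (g p - g (transpose i j \<circ> p)))\<^sup>2"
      using cmod_diff_transpose[OF p _ _ ij(3)]
      by (cases "i \<in> p ` Y"; cases "j \<in> p ` Y") (simp_all only: h_def image_transpose_comp[OF ij(3)] simp_thms if_True if_False, simp_all)
  qed
  moreover have "(\<Sum>p | p permutes S. h p) = 2 * none i j"
    unfolding h_def none_def sum_distrib_left by (intro sum.cong) auto
  ultimately show ?thesis by simp
qed

text \<open>The bound is asymmetric on purpose: only \<open>occ i\<close> is subtracted. This suits
  an edge whose end \<open>i\<close> is rarely exceptional while \<open>j\<close> may be exceptional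
  often.\<close>

lemma dirichlet_ge_occ:
  assumes ij: "i \<in> S" "j \<in> S" "i \<noteq> j"
  shows "mass / 2 + 3 / 2 * none i j - 3 / 2 * occ i \<le> dirichlet S g i j"
proof -
  \<comment> \<open>A permutation with only \<open>j\<close> exceptional is charged
    \<open>w p / 2\<close>; its partner, with only \<open>i\<close> exceptional, is charged the
    negative of its weight. Their sum is bounded by \<open>norm_diff_ge_half\<close>.\<close>
  define h where "h p = (if i \<in> p ` Y then if j \<in> p ` Y then 2 * w p else w p / 2
     else if j \<in> p ` Y then - w p else 0)" for p
  have "(\<Sum>p | p permutes S. h p) \<le> dirichlet S g i j"
  proof (rule dirichlet_ge_sum[OF ij])
    fix p assume p: "p permutes S"
    show "h p + h (transpose i j \<circ> p) \<le> (cmod (g p - g (transpose i j \<circ> p)))\<^sup>2"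
      using cmod_diff_transpose[OF p _ _ ij(3)] norm_diff_ge_half[of "g p" "g (transpose i j \<circ> p)"]
        norm_diff_ge_half[of "g (transpose i j \<circ> p)" "g p"]
      by (cases "i \<in> p ` Y"; cases "j \<in> p ` Y")
        (simp_all only: h_def image_transpose_comp[OF ij(3)] simp_thms if_True if_False,
          simp_all add: norm_minus_commute)
  qed
  moreover have "mass / 2 + 3 / 2 * none i j - 3 / 2 * occ i =
    (\<Sum>p | p permutes S. w p / 2 + 3 / 2 * (if i \<in> p ` Y \<and> j \<in> p ` Y then w p else 0)
       - 3 / 2 * (if i \<in> p ` Y then 0 else w p))"
    unfolding mass_def none_def occ_def
    by (simp only: sum.distrib sum_subtractf sum_distrib_left sum_divide_distrib)
  moreover have "\<dots> \<le> (\<Sum>p | p permutes S. h p)"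
    by (intro sum_mono) (auto simp: h_def)
  ultimately show ?thesis by linarith
qed

text \<open>\<open>V\<close> omits \<open>4 * k\<close> points with the largest \<open>occ\<close>.
  The hypothesis on \<open>card S\<close> leaves at least \<open>4 * k\<^sup>2\<close> points, hence
  \<open>k / card V\<close> is at most \<open>1 / (4 * k)\<close>, and it remains to compare fixed
  multiples of \<open>mass\<close>.\<close>

lemma dirichlet_lower_bound:
  assumes k: "k \<ge> 1" and n: "card S \<ge> 4 * k\<^sup>2 + 4 * k"
  obtains V where "V \<subseteq> S" "card V = card S - 4 * k"
    "\<And>i j. i \<in> V \<Longrightarrow> j \<in> V \<Longrightarrow> i \<noteq> j \<Longrightarrow> 4 * real k / card V * mass \<le> dirichlet S g i j"
    "\<And>i j. i \<in> V \<Longrightarrow> j \<in> S - V \<Longrightarrow> k / card V * mass \<le> dirichlet S g i j"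
proof -
  have "4 * k \<le> card S" using n by simp
  then obtain B where B: "B \<subseteq> S" "card B = 4 * k" "\<And>x y. x \<in> S - B \<Longrightarrow> y \<in> B \<Longrightarrow> occ x \<le> occ y"
    using ex_top_subset[OF finS] by metis
  define V where "V = S - B"
  have finB: "finite B" using B(1) finS finite_subset by blast
  have cV: "card V = card S - 4 * k" using B finB by (simp add: V_def card_Diff_subset)
  have N: "card V \<ge> 4 * k\<^sup>2" using n cV by simp
  have N': "real (card V) \<ge> 4 * real k * real k"
  proof -
    have "real (4 * k * k) \<le> real (card V)" using N by (subst of_nat_le_iff) (simp add: power2_eq_square)
    then show ?thesis by simp
  qed
  have k0: "real k \<ge> 1" using k by simp
  have N0: "real (card V) > 0"
  proof -
    have "real k > 0" using k by simp
    then have "4 * real k * real k > 0" by simp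
    then show ?thesis using N' by linarith
  qed
  \<comment> \<open>The \<open>4 * k - 1\<close> points of \<open>B\<close> other than
    \<open>j\<close> have \<open>occ\<close> at least \<open>occ i\<close>, and
    \<open>occ i + occ j\<close> is at least \<open>mass - none i j\<close>. All these values
    together are at most \<open>k * mass\<close>.\<close>
  have occ_rest: "(4 * real k - 1) * occ i \<le> (real k - 1) * mass + none i j" if "i \<in> V" "j \<in> B" for i j
  proof -
    have "(\<Sum>l\<in>B - {j}. occ i) \<le> (\<Sum>l\<in>B - {j}. occ l)"
      using that B(3) by (intro sum_mono) (auto simp: V_def)
    moreover have "(\<Sum>l\<in>B - {j}. occ i) = (4 * real k - 1) * occ i"
      using that B(2) finB k by (simp add: card_Diff_singleton of_nat_diff)
    moreover have "(\<Sum>l\<in>insert i B. occ l) \<le> (\<Sum>l\<in>S. occ l)"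
      using that B finS by (intro sum_mono2) (auto simp: V_def occ_nonneg)
    moreover have "(\<Sum>l\<in>insert i B. occ l) = occ i + occ j + (\<Sum>l\<in>B - {j}. occ l)"
      using that finB by (simp add: V_def sum.remove[of B j])
    ultimately show ?thesis using sum_occ none_ge[of i j] by (simp add: algebra_simps)
  qed
  have occ_V: "4 * occ i \<le> mass" if "i \<in> V" for i
  proof -
    have "(\<Sum>l\<in>B. occ i) \<le> (\<Sum>l\<in>B. occ l)"
      using that B(3) by (intro sum_mono) (auto simp: V_def)
    also have "\<dots> \<le> (\<Sum>l\<in>S. occ l)"
      using B finS by (intro sum_mono2) (auto simp: occ_nonneg)
    finally have "k * (4 * occ i) \<le> k * mass" using sum_occ B(2) by simp
    then show ?thesis using k by simp
  qed
  show ?thesis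
  proof (rule that[of V])
    fix i j assume ij: "i \<in> V" "j \<in> V" "i \<noteq> j"
    have "4 * real k * 1 \<le> 4 * real k * real k" using k0 by (intro mult_left_mono) auto
    then have "4 * real k / card V \<le> 1" using N' N0 by simp
    then have "4 * real k / card V * mass \<le> 1 * mass" using mass_nonneg by (rule mult_right_mono)
    \<comment> \<open>Each end is exceptional with at most a quarter of the mass, so
      \<open>none i j\<close> is at least half of it.\<close>
    moreover have "1 * mass \<le> 2 * none i j"
      using none_ge[of i j] occ_V[OF ij(1)] occ_V[OF ij(2)] by simp
    moreover have "2 * none i j \<le> dirichlet S g i j" using ij by (intro dirichlet_ge_none) (auto simp: V_def)
    ultimately show "4 * real k / card V * mass \<le> dirichlet S g i j" by linarith
  next
    fix i j assume ij: "i \<in> V" "j \<in> S - V"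
    then have j: "j \<in> B" by (auto simp: V_def)
    have "real k / card V \<le> 1 / (4 * real k)" using N' N0 k0 by (simp add: field_simps)
    then have "real k / card V * mass \<le> 1 / (4 * real k) * mass" using mass_nonneg by (rule mult_right_mono)
    moreover have "1 / (4 * real k) * mass \<le> mass / 2 + 3 / 2 * none i j - 3 / 2 * occ i"
    proof -
      define c where "c = 4 * real k - 1"
      have c: "c \<ge> 3" using k0 by (simp add: c_def)
      have "c * occ i \<le> (real k - 1) * mass + none i j"
        using occ_rest[OF ij(1) j] k by (simp add: c_def of_nat_diff)
      \<comment> \<open>Enlarging the coefficient of \<open>none i j\<close> to \<open>c\<close>
        produces the difference \<open>occ i - none i j\<close>, which is what
        \<open>dirichlet_ge_occ\<close> contains.\<close>
      moreover have "none i j \<le> c * none i j"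
        using c none_nonneg[of i j] mult_right_mono[of 1 c "none i j"] by simp
      ultimately have "c * (occ i - none i j) \<le> (real k - 1) * mass" by (simp add: algebra_simps)
      then have o: "occ i - none i j \<le> (real k - 1) * mass / c" using c by (simp add: field_simps)
      \<comment> \<open>As \<open>c - 3 * (k - 1) = k + 2\<close>, this amounts to
        \<open>2 * c \<le> 4 * k * (k + 2)\<close>.\<close>
      have "1 / (4 * real k) \<le> 1 / 2 - 3 / 2 * ((real k - 1) / c)"
      proof -
        have "1 / (4 * real k) = (real k + 2) / (4 * real k * (real k + 2))" using k0 by simp
        also have "\<dots> \<le> (real k + 2) / (2 * c)"
          using k0 c by (intro frac_le) (auto simp: c_def algebra_simps)
        also have "\<dots> = 1 / 2 - 3 / 2 * ((real k - 1) / c)"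
        proof -
          have "1 / 2 - 3 / 2 * ((real k - 1) / c) = (c - 3 * (real k - 1)) / (2 * c)"
            using c by (simp add: field_simps)
          then show ?thesis by (simp add: c_def)
        qed
        finally show ?thesis .
      qed
      then have "1 / (4 * real k) * mass \<le> (1 / 2 - 3 / 2 * ((real k - 1) / c)) * mass"
        using mass_nonneg by (rule mult_right_mono)
      also have "\<dots> = mass / 2 - 3 / 2 * ((real k - 1) * mass / c)"
        by (simp add: left_diff_distrib)
      finally show ?thesis using o by linarith
    qed
    moreover have "mass / 2 + 3 / 2 * none i j - 3 / 2 * occ i \<le> dirichlet S g i j"
      using ij by (intro dirichlet_ge_occ) (auto simp: V_def)
    ultimately show "real k / card V * mass \<le> dirichlet S g i j" by linarith
  qed (use cV in \<open>auto simp: V_def\<close>)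
qed

end

section \<open>Averaging in unitary representations\<close>

text \<open>A bijection of \<open>A\<close> onto a subset of \<open>B\<close> extends to
  \<open>S\<close> because the two complements have equal size.\<close>

lemma ex_permutes_image_subset:
  assumes finS: "finite S" and "A \<subseteq> S" "B \<subseteq> S" "card A \<le> card B"
  obtains q where "q permutes S" "q ` A \<subseteq> B"
proof -
  obtain U where U: "U \<subseteq> B" "card U = card A" using assms(4) by (meson obtain_subset_with_card_n)
  have US: "U \<subseteq> S" using U assms by blast
  have fin: "finite A" "finite U" using finS assms(2) US finite_subset by blast+
  obtain f where f: "bij_betw f A U" using U(2) fin finite_same_card_bij by metis
  have "card (S - A) = card (S - U)"
    using assms(2) US fin U(2) by (simp add: card_Diff_subset)
  then obtain g where g: "bij_betw g (S - A) (S - U)" using finS finite_same_card_bij by (metis finite_Diff)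
  define q where "q x = (if x \<in> A then f x else if x \<in> S then g x else x)" for x
  have "bij_betw q A U" using f by (rule bij_betw_cong[THEN iffD1, rotated]) (simp add: q_def)
  moreover have "bij_betw q (S - A) (S - U)"
    using g by (rule bij_betw_cong[THEN iffD1, rotated]) (simp add: q_def)
  ultimately have "bij_betw q (A \<union> (S - A)) (U \<union> (S - U))" by (rule bij_betw_combine) auto
  moreover have "A \<union> (S - A) = S" "U \<union> (S - U) = S" using assms US by auto
  ultimately have "q permutes S" by (intro bij_imp_permutes) (use assms(2) in \<open>auto simp: q_def\<close>)
  moreover have "q ` A \<subseteq> B" using \<open>bij_betw q A U\<close> U(1) by (auto simp: bij_betw_def)
  ultimately show ?thesis using that by blast
qed

lemma sum_pair_cong:
  assumes "\<And>i j. (i, j) \<in> E \<Longrightarrow> f i j = g i j"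
  shows "(\<Sum>(i, j)\<in>E. f i j) = (\<Sum>(i, j)\<in>E. g i j)"
  using assms by (intro sum.cong) auto

lemma sum_pair_mono:
  fixes f :: "'a \<Rightarrow> 'b \<Rightarrow> 'c :: ordered_comm_monoid_add"
  assumes "\<And>i j. (i, j) \<in> E \<Longrightarrow> f i j \<le> g i j"
  shows "(\<Sum>(i, j)\<in>E. f i j) \<le> (\<Sum>(i, j)\<in>E. g i j)"
  using assms by (intro sum_mono) auto

lemma cnj_sum_pair: "cnj (\<Sum>(i, j)\<in>E. f i j) = (\<Sum>(i, j)\<in>E. cnj (f i j))"
  by (simp add: case_prod_beta)

lemma Re_sum_pair: "Re (\<Sum>(i, j)\<in>E. f i j) = (\<Sum>(i, j)\<in>E. Re (f i j))"
  by (simp add: case_prod_beta)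

text \<open>The numbers that link the two halves of the proof: upper bounds for averaged energies of
  \<open>\<tau>\<close> and, times \<open>mass\<close>, lower bounds for the energies of an
  alternating function.\<close>

definition edge_weight :: "nat \<Rightarrow> 'a set \<Rightarrow> 'a \<Rightarrow> 'a \<Rightarrow> real" where
  "edge_weight k V i j = (if i \<in> V \<and> j \<in> V then 4 * real k / card V
     else if i \<in> V \<or> j \<in> V then real k / card V else 0)"

text \<open>\<open>Q\<close> consists of the permutations that take no point outside
  \<open>V\<close> to a point with nonzero \<open>h\<close>. It is stable under right multiplication
  by transpositions of \<open>V\<close>, so the average of \<open>h (q i)\<close> is the same for
  all \<open>i\<close> in \<open>V\<close>, and therefore at most \<open>k / card V\<close>.\<close>

lemma average_rates:
  fixes h :: "'a \<Rightarrow> real" and R :: "'a \<Rightarrow> 'a \<Rightarrow> real"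
  assumes finS: "finite S" and V: "V \<subseteq> S" "V \<noteq> {}" "2 * k \<le> card V"
    and h0: "\<And>x. x \<in> S \<Longrightarrow> h x = 0 \<or> h x \<ge> 1/2" and hk: "(\<Sum>x\<in>S. h x) \<le> real k"
    and R0: "\<And>x y. x \<in> S \<Longrightarrow> y \<in> S \<Longrightarrow> x \<noteq> y \<Longrightarrow> h y = 0 \<Longrightarrow> R x y = h x"
    and Rsym: "\<And>x y. R x y = R y x" and R2: "\<And>x y. x \<in> S \<Longrightarrow> y \<in> S \<Longrightarrow> R x y \<le> 2"
  obtains Q where "finite Q" "Q \<noteq> {}" "\<And>q. q \<in> Q \<Longrightarrow> q permutes S"
    "\<And>i j. i \<in> S \<Longrightarrow> j \<in> S \<Longrightarrow> i \<noteq> j \<Longrightarrow> (\<Sum>q\<in>Q. R (q i) (q j)) \<le> card Q * edge_weight k V i j"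
proof -
  define Q where "Q = {q. q permutes S \<and> (\<forall>x\<in>S - V. h (q x) = 0)}"
  have finV: "finite V" using V finS finite_subset by blast
  have N0: "real (card V) > 0" using finV V by (simp add: card_gt_0_iff)
  have hnn: "h x \<ge> 0" if "x \<in> S" for x using h0[OF that] by auto
  have finQ: "finite Q" unfolding Q_def using finite_permutations[OF finS] by (rule rev_finite_subset) auto
  have Qp: "q permutes S" if "q \<in> Q" for q using that by (simp add: Q_def)
  have qS: "q x \<in> S" if "q \<in> Q" "x \<in> S" for q x using permutes_in_image[OF Qp] that by metis
  \<comment> \<open>Values of \<open>h\<close> on \<open>T\<close> are at least 1/2, so
    \<open>T\<close> has at most \<open>2 * k\<close> points and fits into \<open>V\<close>; this
    makes \<open>Q\<close> nonempty.\<close>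
  define T where "T = {x \<in> S. h x \<noteq> 0}"
  have "card T * (1/2) \<le> (\<Sum>x\<in>T. h x)" using h0 sum_bounded_below[of T "1/2" h] by (force simp: T_def)
  also have "\<dots> \<le> (\<Sum>x\<in>S. h x)" using finS hnn by (intro sum_mono2) (auto simp: T_def)
  finally have "real (card T) \<le> real (2 * k)" using hk by simp
  then have "card T \<le> card V" using V(3) by linarith
  then have "card (S - V) \<le> card (S - T)"
    using V finV finS by (simp add: card_Diff_subset T_def diff_le_mono2)
  then obtain q where q: "q permutes S" "q ` (S - V) \<subseteq> S - T"
    using ex_permutes_image_subset[OF finS] by (metis Diff_subset)
  then have neQ: "Q \<noteq> {}" using permutes_in_image[OF q(1)] by (force simp: Q_def T_def image_subset_iff)
  have trans: "q \<circ> transpose i j \<in> Q" if "q \<in> Q" "i \<in> V" "j \<in> V" for q i j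
    using that V by (auto simp: Q_def transpose_def permutes_compose permutes_swap_id subset_iff)
  have same: "(\<Sum>q\<in>Q. h (q i)) = (\<Sum>q\<in>Q. h (q j))" if "i \<in> V" "j \<in> V" for i j
    by (rule sum.reindex_bij_witness[of _ "\<lambda>q. q \<circ> transpose i j" "\<lambda>q. q \<circ> transpose i j"])
      (use that trans in \<open>auto simp: comp_assoc\<close>)
  have havg: "(\<Sum>q\<in>Q. h (q i)) \<le> card Q * (real k / card V)" if i: "i \<in> V" for i
  proof -
    have "card V * (\<Sum>q\<in>Q. h (q i)) = (\<Sum>j\<in>V. \<Sum>q\<in>Q. h (q j))"
      using sum.cong[OF refl same[OF i], of V] by simp
    also have "\<dots> = (\<Sum>q\<in>Q. \<Sum>j\<in>V. h (q j))" by (rule sum.swap)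
    also have "\<dots> \<le> (\<Sum>q\<in>Q. real k)"
    proof (rule sum_mono)
      fix q assume q: "q \<in> Q"
      have "(\<Sum>j\<in>V. h (q j)) \<le> (\<Sum>j\<in>S. h (q j))"
        using V finS hnn qS[OF q] by (intro sum_mono2) auto
      also have "\<dots> = (\<Sum>x\<in>S. h x)" using sum.permute[OF Qp[OF q], of h] by (simp add: comp_def)
      finally show "(\<Sum>j\<in>V. h (q j)) \<le> real k" using hk by simp
    qed
    finally show ?thesis using N0 by (simp add: field_simps)
  qed
  \<comment> \<open>If \<open>h x\<close> and \<open>h y\<close> are both nonzero, the right side is
    at least 2; otherwise \<open>R x y\<close> is one of the two values.\<close>
  have Rle: "R x y \<le> 2 * h x + 2 * h y" if "x \<in> S" "y \<in> S" "x \<noteq> y" for x y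
    using h0[OF that(1)] h0[OF that(2)] R0[OF that] R0[of y x] Rsym[of x y] R2[OF that(1,2)] hnn that
    by fastforce
  show ?thesis
  proof (rule that[OF finQ neQ Qp])
    fix i j assume ij: "i \<in> S" "j \<in> S" "i \<noteq> j"
    have qij: "q i \<noteq> q j" if "q \<in> Q" for q using permutes_inj[OF Qp[OF that]] ij by (simp add: inj_eq)
    have one: "(\<Sum>q\<in>Q. R (q x) (q y)) = (\<Sum>q\<in>Q. h (q x))" if "x \<in> S" "y \<in> S - V" "x \<noteq> y" for x y
      using that qS permutes_inj[OF Qp] by (intro sum.cong R0) (auto simp: Q_def inj_eq)
    consider "i \<in> V" "j \<in> V" | "i \<in> V" "j \<notin> V" | "i \<notin> V" "j \<in> V" | "i \<notin> V" "j \<notin> V" by blast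
    then show "(\<Sum>q\<in>Q. R (q i) (q j)) \<le> card Q * edge_weight k V i j"
    proof cases
      case 1
      have "(\<Sum>q\<in>Q. R (q i) (q j)) \<le> (\<Sum>q\<in>Q. 2 * h (q i) + 2 * h (q j))"
        using ij qS qij by (intro sum_mono Rle) auto
      also have "\<dots> = 2 * (\<Sum>q\<in>Q. h (q i)) + 2 * (\<Sum>q\<in>Q. h (q j))"
        by (simp add: sum.distrib sum_distrib_left)
      also have "\<dots> \<le> 4 * (card Q * (real k / card V))" using havg[OF 1(1)] havg[OF 1(2)] by linarith
      finally show ?thesis using 1 by (simp add: edge_weight_def mult_ac)
    next
      case 2
      then show ?thesis using one[of i j] havg[of i] ij by (simp add: edge_weight_def)
    next
      case 3
      then show ?thesis using one[of j i] havg[of j] ij Rsym by (simp add: edge_weight_def)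
    next
      case 4
      then have "(\<Sum>q\<in>Q. R (q i) (q j)) = 0"
        using one[of i j] ij by (auto simp: Q_def intro!: sum.neutral)
      then show ?thesis using 4 by (simp add: edge_weight_def)
    qed
  qed
qed

section \<open>Adjoints, invertible matrices and unitary representations\<close>

lemma mat_adjoint_carrier:
  "A \<in> carrier_mat d d \<Longrightarrow> mat_adjoint A \<in> carrier_mat d d"
  unfolding mat_adjoint_def by (metis cols_length carrier_matD length_map mat_of_rows_carrier(1))

lemma mat_adjoint_index:
  assumes "A \<in> carrier_mat d d" "i < d" "j < d"
  shows "mat_adjoint A $$ (i, j) = conjugate (A $$ (j, i))"
  using assms by (simp add: mat_adjoint_def mat_of_rows_index)

lemma inner_mat_adjoint:
  assumes "A \<in> carrier_mat d d" "v \<in> carrier_vec d" "w \<in> carrier_vec d"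
  shows "(A *\<^sub>v v) \<bullet>c w = v \<bullet>c (mat_adjoint A *\<^sub>v (w :: complex vec))"
proof -
  have dim: "mat_adjoint A \<in> carrier_mat d d" using mat_adjoint_carrier[OF assms(1)] by simp
  have "(A *\<^sub>v v) \<bullet>c w = (\<Sum>i<d. (\<Sum>j<d. A $$ (i, j) * v $ j) * cnj (w $ i))"
    using assms by (simp add: scalar_prod_def lessThan_atLeast0)
  also have "\<dots> = (\<Sum>j<d. v $ j * cnj (\<Sum>i<d. cnj (A $$ (i, j)) * w $ i))"
    unfolding sum_distrib_right cnj_sum sum_distrib_left
    by (subst sum.swap) (simp add: mult_ac)
  also have "\<dots> = v \<bullet>c (mat_adjoint A *\<^sub>v w)"
    using assms dim by (simp add: scalar_prod_def lessThan_atLeast0 mat_adjoint_index[OF assms(1)])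
  finally show ?thesis .
qed

lemma GL_carrier: "A \<in> carrier (GL d) \<Longrightarrow> A \<in> carrier_mat d d"
  by (auto simp: GL_def units_of_def Units_def ring_mat_def)

lemma GL_mult: "A \<otimes>\<^bsub>GL d\<^esub> B = A * B"
  by (simp add: GL_def units_of_def ring_mat_def)

lemma GL_one: "\<one>\<^bsub>GL d\<^esub> = 1\<^sub>m d"
  by (simp add: GL_def units_of_def ring_mat_def)

lemma GL_group: "group (GL d)"
proof -
  interpret ring "ring_mat TYPE(complex) d ()" by (rule ring_mat)
  show ?thesis unfolding GL_def by (rule units_group)
qed

lemma GL_injective:
  assumes "A \<in> carrier (GL d)" "v \<in> carrier_vec d" "A *\<^sub>v v = 0\<^sub>v d"
  shows "v = 0\<^sub>v d"
proof -
  interpret group "GL d" by (rule GL_group)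
  have B: "inv\<^bsub>GL d\<^esub> A \<in> carrier_mat d d" using assms(1) by (intro GL_carrier) simp
  have "inv\<^bsub>GL d\<^esub> A * A = 1\<^sub>m d" using l_inv[OF assms(1)] by (simp add: GL_mult GL_one)
  then have "v = (inv\<^bsub>GL d\<^esub> A * A) *\<^sub>v v" using assms(2) by simp
  also have "\<dots> = inv\<^bsub>GL d\<^esub> A *\<^sub>v 0\<^sub>v d"
    using assms B GL_carrier[OF assms(1)] by (simp add: assoc_mult_mat_vec[of _ d d _ d])
  also have "\<dots> = 0\<^sub>v d" using B by (intro eq_vecI) auto
  finally show ?thesis .
qed

lemma
  assumes "representation n \<rho>"
  shows representation_carrier: "p permutes {1..n} \<Longrightarrow> \<rho> p \<in> carrier_mat (degree_rep \<rho>) (degree_rep \<rho>)"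
    and representation_comp: "p permutes {1..n} \<Longrightarrow> q permutes {1..n} \<Longrightarrow> \<rho> (p \<circ> q) = \<rho> p * \<rho> q"
    and representation_id: "\<rho> id = 1\<^sub>m (degree_rep \<rho>)"
proof -
  have h: "\<rho> \<in> hom (sym_group n) (GL (degree_rep \<rho>))" using assms by (simp add: representation_def)
  show "p permutes {1..n} \<Longrightarrow> \<rho> p \<in> carrier_mat (degree_rep \<rho>) (degree_rep \<rho>)"
    using h by (auto simp: hom_def sym_group_carrier intro!: GL_carrier)
  show "p permutes {1..n} \<Longrightarrow> q permutes {1..n} \<Longrightarrow> \<rho> (p \<circ> q) = \<rho> p * \<rho> q"
    using h by (auto simp: hom_def sym_group_carrier sym_group_mult GL_mult)
  have "\<rho> \<one>\<^bsub>sym_group n\<^esub> = \<one>\<^bsub>GL (degree_rep \<rho>)\<^esub>"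
    using hom_one[OF h sym_group_is_group GL_group] .
  then show "\<rho> id = 1\<^sub>m (degree_rep \<rho>)" by (simp add: sym_group_one GL_one)
qed

lemma representation_comp_vec:
  assumes "representation n \<rho>" "p permutes {1..n}" "q permutes {1..n}" "v \<in> carrier_vec (degree_rep \<rho>)"
  shows "\<rho> (p \<circ> q) *\<^sub>v v = \<rho> p *\<^sub>v (\<rho> q *\<^sub>v v)"
  using assms representation_carrier[OF assms(1)]
  by (simp add: representation_comp[OF assms(1)] assoc_mult_mat_vec[of _ "degree_rep \<rho>" "degree_rep \<rho>" _ "degree_rep \<rho>"])

lemma representation_vec_carrier:
  assumes "representation n \<rho>" "p permutes {1..n}" "v \<in> carrier_vec (degree_rep \<rho>)"
  shows "\<rho> p *\<^sub>v v \<in> carrier_vec (degree_rep \<rho>)"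
  using representation_carrier[OF assms(1,2)] assms(3) by auto

lemma unitary_rep_inner:
  assumes "unitary_rep n \<rho>" "p permutes {1..n}" "v \<in> carrier_vec (degree_rep \<rho>)" "w \<in> carrier_vec (degree_rep \<rho>)"
  shows "(\<rho> p *\<^sub>v v) \<bullet>c (\<rho> p *\<^sub>v w) = v \<bullet>c w"
proof -
  have rep: "representation n \<rho>" and adj: "mat_adjoint (\<rho> p) * \<rho> p = 1\<^sub>m (degree_rep \<rho>)"
    using assms(1,2) by (auto simp: unitary_rep_def sym_group_carrier)
  note C = representation_carrier[OF rep assms(2)]
  have "mat_adjoint (\<rho> p) \<in> carrier_mat (degree_rep \<rho>) (degree_rep \<rho>)"
    using mat_adjoint_carrier[OF C] by simp
  then have "mat_adjoint (\<rho> p) *\<^sub>v (\<rho> p *\<^sub>v w) = w"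
    using C assms(4) adj by (metis assoc_mult_mat_vec one_mult_mat_vec)
  moreover have "\<rho> p *\<^sub>v w \<in> carrier_vec (degree_rep \<rho>)" using C assms(4) by auto
  ultimately show ?thesis using inner_mat_adjoint[OF C assms(3)] by simp
qed

lemma unitary_rep_sqnorm:
  assumes "unitary_rep n \<rho>" "p permutes {1..n}" "v \<in> carrier_vec (degree_rep \<rho>)"
  shows "sqnorm (\<rho> p *\<^sub>v v) = sqnorm v"
  using unitary_rep_inner[OF assms assms(3)] by (simp add: sqnorm_def)

section \<open>The Laplacian and its smallest eigenvalue\<close>

definition edges :: "nat \<Rightarrow> (nat \<times> nat) set" where
  "edges n = {(i, j). 1 \<le> i \<and> i < j \<and> j \<le> n}"

lemma finite_edges: "finite (edges n)"
  by (rule finite_subset[of _ "{1..n} \<times> {1..n}"]) (auto simp: edges_def)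

lemma edgesD: "(i, j) \<in> edges n \<Longrightarrow> i \<in> {1..n} \<and> j \<in> {1..n} \<and> i \<noteq> j"
  by (auto simp: edges_def)

lemma laplacian_carrier: "laplacian n a \<rho> \<in> carrier_mat (degree_rep \<rho>) (degree_rep \<rho>)"
  by (simp add: laplacian_def)

lemma laplacian_mult_vec_index:
  assumes rep: "representation n \<rho>" and v: "v \<in> carrier_vec (degree_rep \<rho>)" and l: "l < degree_rep \<rho>"
  shows "(laplacian n a \<rho> *\<^sub>v v) $ l =
    (\<Sum>(i, j)\<in>edges n. complex_of_real (a i j) * (v $ l - (\<rho> (transpose i j) *\<^sub>v v) $ l))"
proof -
  let ?d = "degree_rep \<rho>"
  have "(laplacian n a \<rho> *\<^sub>v v) $ l = (\<Sum>m<?d. (\<Sum>(i, j)\<in>edges n.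
       complex_of_real (a i j) * ((\<rho> id - \<rho> (transpose i j)) $$ (l, m))) * v $ m)"
    using v l by (simp add: laplacian_def scalar_prod_def lessThan_atLeast0 edges_def)
  also have "\<dots> = (\<Sum>(i, j)\<in>edges n. complex_of_real (a i j) * (\<Sum>m<?d. (\<rho> id - \<rho> (transpose i j)) $$ (l, m) * v $ m))"
    unfolding sum_distrib_right by (subst sum.swap) (auto simp: sum_distrib_left mult.assoc intro!: sum.cong)
  also have "\<dots> = (\<Sum>(i, j)\<in>edges n. complex_of_real (a i j) * (v $ l - (\<rho> (transpose i j) *\<^sub>v v) $ l))"
  proof (rule sum_pair_cong)
    fix i j assume "(i, j) \<in> edges n"
    then have t: "transpose i j permutes {1..n}" using edgesD by (intro permutes_swap_id) blast+
    note C = representation_carrier[OF rep t] representation_carrier[OF rep permutes_id]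
    have "(\<Sum>m<?d. (\<rho> id - \<rho> (transpose i j)) $$ (l, m) * v $ m)
        = ((\<rho> id - \<rho> (transpose i j)) *\<^sub>v v) $ l"
      using C v l by (simp add: scalar_prod_def lessThan_atLeast0)
    also have "(\<rho> id - \<rho> (transpose i j)) *\<^sub>v v = v - \<rho> (transpose i j) *\<^sub>v v"
      using C v representation_id[OF rep] by (simp add: minus_mult_distrib_mat_vec[of _ ?d ?d])
    also have "(v - \<rho> (transpose i j) *\<^sub>v v) $ l = v $ l - (\<rho> (transpose i j) *\<^sub>v v) $ l"
      using C v l by simp
    finally show "complex_of_real (a i j) * (\<Sum>m<?d. (\<rho> id - \<rho> (transpose i j)) $$ (l, m) * v $ m)
       = complex_of_real (a i j) * (v $ l - (\<rho> (transpose i j) *\<^sub>v v) $ l)"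
      by (simp only:)
  qed
  finally show ?thesis .
qed

lemma laplacian_inner:
  assumes rep: "representation n \<rho>" and v: "v \<in> carrier_vec (degree_rep \<rho>)" and w: "w \<in> carrier_vec (degree_rep \<rho>)"
  shows "(laplacian n a \<rho> *\<^sub>v v) \<bullet>c w =
    (\<Sum>(i, j)\<in>edges n. complex_of_real (a i j) * (v \<bullet>c w - (\<rho> (transpose i j) *\<^sub>v v) \<bullet>c w))"
proof -
  let ?d = "degree_rep \<rho>"
  have "(laplacian n a \<rho> *\<^sub>v v) \<bullet>c w = (\<Sum>l<?d. (laplacian n a \<rho> *\<^sub>v v) $ l * cnj (w $ l))"
    using w by (simp add: scalar_prod_def lessThan_atLeast0)
  also have "\<dots> = (\<Sum>l<?d. (\<Sum>(i, j)\<in>edges n. complex_of_real (a i j) *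
      (v $ l - (\<rho> (transpose i j) *\<^sub>v v) $ l)) * cnj (w $ l))"
    by (intro sum.cong refl) (simp add: laplacian_mult_vec_index[OF rep v])
  also have "\<dots> = (\<Sum>(i, j)\<in>edges n. complex_of_real (a i j) *
      (\<Sum>l<?d. (v $ l - (\<rho> (transpose i j) *\<^sub>v v) $ l) * cnj (w $ l)))"
    unfolding sum_distrib_right by (subst sum.swap) (auto simp: sum_distrib_left mult.assoc intro!: sum.cong)
  also have "\<dots> = (\<Sum>(i, j)\<in>edges n. complex_of_real (a i j) * (v \<bullet>c w - (\<rho> (transpose i j) *\<^sub>v v) \<bullet>c w))"
    using w by (intro sum.cong refl)
      (auto simp: scalar_prod_def lessThan_atLeast0 left_diff_distrib sum_subtractf)
  finally show ?thesis .
qed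

text \<open>A unitary involution is self-adjoint.\<close>

lemma unitary_rep_transpose_selfadjoint:
  assumes u: "unitary_rep n \<rho>" and ij: "i \<in> {1..n}" "j \<in> {1..n}"
    and v: "v \<in> carrier_vec (degree_rep \<rho>)" and w: "w \<in> carrier_vec (degree_rep \<rho>)"
  shows "(\<rho> (transpose i j) *\<^sub>v v) \<bullet>c w = v \<bullet>c (\<rho> (transpose i j) *\<^sub>v w)"
proof -
  have rep: "representation n \<rho>" using u by (simp add: unitary_rep_def)
  have t: "transpose i j permutes {1..n}" using ij by (rule permutes_swap_id)
  have "\<rho> (transpose i j) *\<^sub>v (\<rho> (transpose i j) *\<^sub>v w) = w"
    using representation_comp_vec[OF rep t t w] representation_id[OF rep] w by simp
  then show ?thesis
    using unitary_rep_inner[OF u t v representation_vec_carrier[OF rep t w]] by simp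
qed

lemma laplacian_selfadjoint:
  assumes u: "unitary_rep n \<rho>"
  shows "selfadjoint_mat (degree_rep \<rho>) (laplacian n a \<rho>)"
  unfolding selfadjoint_mat_def
proof (intro conjI ballI laplacian_carrier)
  let ?d = "degree_rep \<rho>"
  have rep: "representation n \<rho>" using u by (simp add: unitary_rep_def)
  fix v w :: "complex vec" assume v: "v \<in> carrier_vec ?d" and w: "w \<in> carrier_vec ?d"
  have Lw: "laplacian n a \<rho> *\<^sub>v w \<in> carrier_vec ?d"
    by (rule mult_mat_vec_carrier[OF laplacian_carrier w])
  have "v \<bullet>c (laplacian n a \<rho> *\<^sub>v w) = cnj ((laplacian n a \<rho> *\<^sub>v w) \<bullet>c v)"
    by (rule inner_commute[OF Lw v])
  also have "\<dots> = (\<Sum>(i, j)\<in>edges n. complex_of_real (a i j) * (v \<bullet>c w - v \<bullet>c (\<rho> (transpose i j) *\<^sub>v w)))"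
    unfolding laplacian_inner[OF rep w v] cnj_sum_pair
  proof (rule sum_pair_cong)
    fix i j assume "(i, j) \<in> edges n"
    then have t: "transpose i j permutes {1..n}" using edgesD by (intro permutes_swap_id) blast+
    show "cnj (complex_of_real (a i j) * (w \<bullet>c v - (\<rho> (transpose i j) *\<^sub>v w) \<bullet>c v)) =
      complex_of_real (a i j) * (v \<bullet>c w - v \<bullet>c (\<rho> (transpose i j) *\<^sub>v w))"
      using inner_commute[OF w v] inner_commute[OF representation_vec_carrier[OF rep t w] v] by simp
  qed
  also have "\<dots> = (laplacian n a \<rho> *\<^sub>v v) \<bullet>c w"
    unfolding laplacian_inner[OF rep v w]
  proof (rule sum_pair_cong)
    fix i j assume "(i, j) \<in> edges n"
    then have ij: "i \<in> {1..n}" "j \<in> {1..n}" using edgesD by blast+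
    show "complex_of_real (a i j) * (v \<bullet>c w - v \<bullet>c (\<rho> (transpose i j) *\<^sub>v w)) =
      complex_of_real (a i j) * (v \<bullet>c w - (\<rho> (transpose i j) *\<^sub>v v) \<bullet>c w)"
      by (simp only: unitary_rep_transpose_selfadjoint[OF u ij v w])
  qed
  finally show "(laplacian n a \<rho> *\<^sub>v v) \<bullet>c w = v \<bullet>c (laplacian n a \<rho> *\<^sub>v w)" by simp
qed

text \<open>Self-adjointness makes all complex eigenvalues real, so in positive degree the set in
  \<open>lambda1\<close> is nonempty as well as finite, and its \<open>Min\<close> is
  meaningful.\<close>

lemma
  assumes u: "unitary_rep n \<rho>" and d: "degree_rep \<rho> > 0"
  shows lambda1_eigenvalue: "eigenvalue (laplacian n a \<rho>) (complex_of_real (lambda1 n a \<rho>))"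
    and lambda1_le: "eigenvalue (laplacian n a \<rho>) (complex_of_real x) \<Longrightarrow> lambda1 n a \<rho> \<le> x"
proof -
  let ?L = "laplacian n a \<rho>" and ?X = "{x. eigenvalue (laplacian n a \<rho>) (complex_of_real x)}"
  have "?X \<subseteq> Re ` spectrum ?L" by (auto simp: spectrum_def image_iff intro!: exI[of _ "complex_of_real _"])
  then have fin: "finite ?X"
    using card_finite_spectrum(1)[OF laplacian_carrier] by (meson finite_imageI finite_subset)
  obtain e where "e \<in> spectrum ?L" using spectrum_non_empty[OF laplacian_carrier d] by blast
  then have "eigenvalue ?L e" by (simp add: spectrum_def)
  then have "Re e \<in> ?X" using selfadjoint_eigenvalue_real[OF laplacian_selfadjoint[OF u]] by force
  then have "lambda1 n a \<rho> \<in> ?X" unfolding lambda1_def using fin by (intro Min_in) auto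
  then show "eigenvalue ?L (complex_of_real (lambda1 n a \<rho>))" by simp
  show "eigenvalue ?L (complex_of_real x) \<Longrightarrow> lambda1 n a \<rho> \<le> x"
    unfolding lambda1_def using fin by (intro Min_le) auto
qed

text \<open>Translating a test vector by the inverse of \<open>q\<close> relabels every edge by
  \<open>q\<close>, since (i j) q^-1 = q^-1 (q(i) q(j)).\<close>

lemma unitary_rep_conj_transpose:
  assumes u: "unitary_rep n \<rho>" and q: "q permutes {1..n}" and ij: "i \<in> {1..n}" "j \<in> {1..n}"
    and v: "v \<in> carrier_vec (degree_rep \<rho>)"
  defines "w \<equiv> \<rho> (inv_into UNIV q) *\<^sub>v v"
  shows "(\<rho> (transpose i j) *\<^sub>v w) \<bullet>c w = (\<rho> (transpose (q i) (q j)) *\<^sub>v v) \<bullet>c v"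
proof -
  have rep: "representation n \<rho>" using u by (simp add: unitary_rep_def)
  have p: "inv_into UNIV q permutes {1..n}" using permutes_inv[OF q] .
  have t: "transpose i j permutes {1..n}" using ij by (rule permutes_swap_id)
  have t': "transpose (q i) (q j) permutes {1..n}"
    using ij permutes_in_image[OF q] by (intro permutes_swap_id) auto
  have "transpose i j \<circ> inv_into UNIV q = inv_into UNIV q \<circ> transpose (q i) (q j)"
    using permutes_inverses[OF q] permutes_inj[OF q]
    by (auto simp: fun_eq_iff transpose_def)
  then have "\<rho> (transpose i j) *\<^sub>v w = \<rho> (inv_into UNIV q) *\<^sub>v (\<rho> (transpose (q i) (q j)) *\<^sub>v v)"
    unfolding w_def
    using representation_comp_vec[OF rep t p v] representation_comp_vec[OF rep p t' v] by simp
  then show ?thesis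
    unfolding w_def using unitary_rep_inner[OF u p representation_vec_carrier[OF rep t' v] v] by simp
qed

text \<open>Every translate of \<open>v\<close> is a test vector. The Rayleigh quotients of the
  translates by inverses of \<open>q\<close> in \<open>Q\<close> are averaged, and
  \<open>average_rates\<close> is applied to the normalized edge energies \<open>R\<close> of
  \<open>v\<close>.\<close>

lemma lambda1_upper_bound:
  assumes u: "unitary_rep n \<rho>" and d: "degree_rep \<rho> > 0"
    and v: "v \<in> carrier_vec (degree_rep \<rho>)" "v \<noteq> 0\<^sub>v (degree_rep \<rho>)"
    and h0: "\<And>x. x \<in> {1..n} \<Longrightarrow> h x = 0 \<or> h x \<ge> 1/2" and hk: "(\<Sum>x\<in>{1..n}. h x) \<le> real k"
    and hv: "\<And>i j. i \<in> {1..n} \<Longrightarrow> j \<in> {1..n} \<Longrightarrow> i \<noteq> j \<Longrightarrow> h j = 0 \<Longrightarrow>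
        Re ((\<rho> (transpose i j) *\<^sub>v v) \<bullet>c v) = (1 - h i) * sqnorm v"
    and V: "V \<subseteq> {1..n}" "V \<noteq> {}" "2 * k \<le> card V"
    and a: "\<And>i j. 1 \<le> i \<Longrightarrow> i < j \<Longrightarrow> j \<le> n \<Longrightarrow> 0 \<le> a i j"
  shows "lambda1 n a \<rho> \<le> (\<Sum>(i, j)\<in>edges n. a i j * edge_weight k V i j)"
proof -
  have rep: "representation n \<rho>" using u by (simp add: unitary_rep_def)
  have v0: "sqnorm v > 0" using sqnorm_pos v by blast
  define R where "R i j = 1 - Re ((\<rho> (transpose i j) *\<^sub>v v) \<bullet>c v) / sqnorm v" for i j
  \<comment> \<open>Equivalent to the squared norm of (i j) v + v being nonnegative.\<close>
  have R2: "R i j \<le> 2" if ij: "i \<in> {1..n}" "j \<in> {1..n}" for i j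
  proof -
    have t: "transpose i j permutes {1..n}" using ij by (rule permutes_swap_id)
    have C: "\<rho> (transpose i j) *\<^sub>v v \<in> carrier_vec (degree_rep \<rho>)" by (rule representation_vec_carrier[OF rep t v(1)])
    have n1: "sqnorm (\<rho> (transpose i j) *\<^sub>v v) = sqnorm v" by (rule unitary_rep_sqnorm[OF u t v(1)])
    have "(\<rho> (transpose i j) *\<^sub>v v) \<bullet>c (- v) = - ((\<rho> (transpose i j) *\<^sub>v v) \<bullet>c v)" "sqnorm (- v) = sqnorm v"
      using C v(1) by (auto simp: sqnorm_eq_sum scalar_prod_def sum_negf)
    then have "0 \<le> 2 * sqnorm v + 2 * Re ((\<rho> (transpose i j) *\<^sub>v v) \<bullet>c v)"
      using sqnorm_diff[OF C, of "- v"] v(1) sqnorm_nonneg[of "\<rho> (transpose i j) *\<^sub>v v - (- v)"] n1 by simp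
    then show ?thesis using v0 by (simp add: R_def field_simps)
  qed
  have R0: "R x y = h x" if "x \<in> {1..n}" "y \<in> {1..n}" "x \<noteq> y" "h y = 0" for x y
    using hv[OF that] v0 by (simp add: R_def)
  have Rsym: "R x y = R y x" for x y by (simp add: R_def transpose_commute)
  obtain Q where Q: "finite Q" "Q \<noteq> {}" "\<And>q. q \<in> Q \<Longrightarrow> q permutes {1..n}"
    "\<And>i j. i \<in> {1..n} \<Longrightarrow> j \<in> {1..n} \<Longrightarrow> i \<noteq> j \<Longrightarrow>
       (\<Sum>q\<in>Q. R (q i) (q j)) \<le> card Q * edge_weight k V i j"
    by (rule average_rates[of "{1..n}" V k h R, OF finite_atLeastAtMost V h0 hk R0 Rsym R2];
        (assumption | (rule that; assumption)))
  have each: "lambda1 n a \<rho> \<le> (\<Sum>(i, j)\<in>edges n. a i j * R (q i) (q j))" if q: "q \<in> Q" for q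
  proof -
    define w where "w = \<rho> (inv_into UNIV q) *\<^sub>v v"
    note p = permutes_inv[OF Q(3)[OF q]]
    have w: "w \<in> carrier_vec (degree_rep \<rho>)" unfolding w_def by (rule representation_vec_carrier[OF rep p v(1)])
    have sw: "sqnorm w = sqnorm v" unfolding w_def by (rule unitary_rep_sqnorm[OF u p v(1)])
    have "lambda1 n a \<rho> * sqnorm w \<le> Re ((laplacian n a \<rho> *\<^sub>v w) \<bullet>c w)"
      by (rule selfadjoint_rayleigh[OF laplacian_selfadjoint[OF u] w]) (rule lambda1_le[OF u d])
    also have "\<dots> = (\<Sum>(i, j)\<in>edges n. a i j * R (q i) (q j) * sqnorm v)"
      unfolding laplacian_inner[OF rep w w] Re_sum_pair
    proof (rule sum_pair_cong)
      fix i j assume "(i, j) \<in> edges n"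
      then have ij: "i \<in> {1..n}" "j \<in> {1..n}" using edgesD by blast+
      have "(\<rho> (transpose i j) *\<^sub>v w) \<bullet>c w = (\<rho> (transpose (q i) (q j)) *\<^sub>v v) \<bullet>c v"
        unfolding w_def by (rule unitary_rep_conj_transpose[OF u Q(3)[OF q] ij v(1)])
      then show "Re (complex_of_real (a i j) * (w \<bullet>c w - (\<rho> (transpose i j) *\<^sub>v w) \<bullet>c w))
          = a i j * R (q i) (q j) * sqnorm v"
        using sw v0 by (simp add: inner_self R_def field_simps)
    qed
    also have "\<dots> = (\<Sum>(i, j)\<in>edges n. a i j * R (q i) (q j)) * sqnorm v"
      unfolding sum_distrib_right by (intro sum.cong) auto
    finally show ?thesis using v0 sw by simp
  qed
  have "card Q * lambda1 n a \<rho> \<le> (\<Sum>q\<in>Q. \<Sum>(i, j)\<in>edges n. a i j * R (q i) (q j))"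
    using sum_bounded_below[of Q "lambda1 n a \<rho>"] each by simp
  also have "\<dots> = (\<Sum>(i, j)\<in>edges n. a i j * (\<Sum>q\<in>Q. R (q i) (q j)))"
    by (subst sum.swap) (auto simp: sum_distrib_left intro!: sum.cong)
  also have "\<dots> \<le> (\<Sum>(i, j)\<in>edges n. a i j * (card Q * edge_weight k V i j))"
  proof (rule sum_pair_mono)
    fix i j assume e: "(i, j) \<in> edges n"
    then have "0 \<le> a i j" using a by (auto simp: edges_def)
    then show "a i j * (\<Sum>q\<in>Q. R (q i) (q j)) \<le> a i j * (card Q * edge_weight k V i j)"
      using Q(4) edgesD[OF e] by (intro mult_left_mono) auto
  qed
  also have "\<dots> = card Q * (\<Sum>(i, j)\<in>edges n. a i j * edge_weight k V i j)"
    unfolding sum_distrib_left by (intro sum.cong) (auto simp: mult_ac)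
  finally show ?thesis using Q(1,2) by (simp add: card_gt_0_iff)
qed

section \<open>Polytabloids\<close>

lemma tabloid_of_comp: "tabloid_of r (p \<circ> t) = map ((`) p) (tabloid_of r t)"
  by (simp add: tabloid_of_def image_image)

lemma tabloid_of_transpose_row:
  assumes "inj_on t (young_diagram r)" "b \<in> young_diagram r" "b' \<in> young_diagram r" "fst b = fst b'"
  shows "tabloid_of r (transpose (t b) (t b') \<circ> t) = tabloid_of r t"
proof -
  have "(transpose (t b) (t b') \<circ> t) ` {c \<in> young_diagram r. fst c = i} = t ` {c \<in> young_diagram r. fst c = i}" for i
  proof (cases "fst b = i")
    case True
    then have "t b \<in> t ` {c \<in> young_diagram r. fst c = i}" "t b' \<in> t ` {c \<in> young_diagram r. fst c = i}"
      using assms by auto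
    then show ?thesis unfolding image_comp[symmetric] by simp
  next
    case False
    then have "t c \<noteq> t b" "t c \<noteq> t b'" if "c \<in> young_diagram r" "fst c = i" for c
      using inj_on_eq_iff[OF assms(1)] assms(2-4) that by auto
    then show ?thesis by (intro image_cong refl) (simp add: transpose_def)
  qed
  then show ?thesis by (simp add: tabloid_of_def)
qed

lemma column_stabilizer_permutes: "q \<in> column_stabilizer n r t \<Longrightarrow> q permutes {1..n}"
  by (simp add: column_stabilizer_def sym_group_carrier)

lemma finite_column_stabilizer: "finite (column_stabilizer n r t)"
  by (rule finite_subset[OF _ finite_permutations[of "{1..n}"]]) (auto dest: column_stabilizer_permutes)

lemma column_stabilizer_comp:
  "p \<in> column_stabilizer n r t \<Longrightarrow> q \<in> column_stabilizer n r t \<Longrightarrow> p \<circ> q \<in> column_stabilizer n r t"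
  unfolding column_stabilizer_def sym_group_carrier mem_Collect_eq image_comp[symmetric]
  by (simp add: permutes_compose)

lemma column_stabilizer_image:
  assumes "q \<in> column_stabilizer n r t" "b \<in> young_diagram r"
  shows "q (t b) \<in> t ` {c \<in> young_diagram r. snd c = snd b}"
proof -
  have "q (t b) \<in> q ` t ` {c \<in> young_diagram r. snd c = snd b}" using assms(2) by blast
  then show ?thesis using assms(1) by (simp only: column_stabilizer_def mem_Collect_eq)
qed

lemma transpose_in_column_stabilizer:
  assumes t: "bij_betw t (young_diagram r) {1..n}"
    and b: "b \<in> young_diagram r" "b' \<in> young_diagram r" "snd b = snd b'"
  shows "transpose (t b) (t b') \<in> column_stabilizer n r t"
proof -
  have "transpose (t b) (t b') ` t ` {c \<in> young_diagram r. snd c = j} = t ` {c \<in> young_diagram r. snd c = j}" for j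
  proof (cases "snd b = j")
    case True
    then have "t b \<in> t ` {c \<in> young_diagram r. snd c = j}" "t b' \<in> t ` {c \<in> young_diagram r. snd c = j}"
      using b by auto
    then show ?thesis by simp
  next
    case False
    then have "t c \<noteq> t b" "t c \<noteq> t b'" if "c \<in> young_diagram r" "snd c = j" for c
      using b t that by (auto simp: bij_betw_def dest: inj_onD)
    then show ?thesis by (force simp: image_iff transpose_def)
  qed
  moreover have "transpose (t b) (t b') permutes {1..n}"
    using t b by (intro permutes_swap_id) (auto simp: bij_betw_def)
  ultimately show ?thesis by (simp add: column_stabilizer_def sym_group_carrier)
qed

lemma sign_transpose_comp:
  assumes "finite S" "q permutes S" "x \<noteq> y"
  shows "sign (transpose x y \<circ> q) = - sign q"
proof -
  have "permutation q" using assms permutation_permutes by blast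
  then show ?thesis using assms(3) by (simp add: sign_compose permutation_swap_id sign_swap_id)
qed

text \<open>Left multiplication by a transposition within a column permutes the column stabilizer
  and reverses signs.\<close>

lemma sum_column_stabilizer_transpose:
  fixes F :: "(nat \<Rightarrow> nat) \<Rightarrow> complex"
  assumes t: "bij_betw t (young_diagram r) {1..n}"
    and b: "b \<in> young_diagram r" "b' \<in> young_diagram r" "snd b = snd b'" "b \<noteq> b'"
  shows "(\<Sum>q\<in>column_stabilizer n r t. of_int (sign q) * F (transpose (t b) (t b') \<circ> q))
    = - (\<Sum>q\<in>column_stabilizer n r t. of_int (sign q) * F q)"
proof -
  let ?u = "transpose (t b) (t b')"
  have u: "?u \<in> column_stabilizer n r t" by (rule transpose_in_column_stabilizer[OF t b(1-3)])
  have ne: "t b \<noteq> t b'" using t b by (auto simp: bij_betw_def dest: inj_onD)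
  have "(\<Sum>q\<in>column_stabilizer n r t. of_int (sign q) * F (?u \<circ> q))
      = (\<Sum>q\<in>column_stabilizer n r t. of_int (sign (?u \<circ> q)) * F q)"
    by (rule sum.reindex_bij_witness[of _ "\<lambda>q. ?u \<circ> q" "\<lambda>q. ?u \<circ> q"])
      (auto simp: comp_assoc[symmetric] intro!: column_stabilizer_comp u)
  also have "\<dots> = (\<Sum>q\<in>column_stabilizer n r t. - (of_int (sign q) * F q))"
    by (intro sum.cong refl)
      (simp add: sign_transpose_comp[OF finite_atLeastAtMost column_stabilizer_permutes ne])
  finally show ?thesis by (simp add: sum_negf)
qed

lemma map_image_inv_eq_iff:
  assumes "bij p"
  shows "Y = map ((`) (inv_into UNIV p)) X \<longleftrightarrow> map ((`) p) Y = X"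
proof
  assume "Y = map ((`) (inv_into UNIV p)) X"
  then show "map ((`) p) Y = X" using assms by (simp add: map_idI image_f_inv_f bij_is_surj comp_def)
next
  assume "map ((`) p) Y = X"
  then show "Y = map ((`) (inv_into UNIV p)) X"
    using assms by (auto simp: map_idI image_inv_f_f bij_is_inj comp_def)
qed

lemma tabloid_action_polytabloid:
  assumes "bij p"
  shows "tabloid_action p (polytabloid n r t) X =
    (\<Sum>q\<in>column_stabilizer n r t. of_int (sign q) * (if tabloid_of r (p \<circ> q \<circ> t) = X then 1 else 0))"
proof -
  have "tabloid_of r (q \<circ> t) = map ((`) (inv_into UNIV p)) X \<longleftrightarrow> tabloid_of r (p \<circ> q \<circ> t) = X" for q
    unfolding comp_assoc tabloid_of_comp[of r p] by (rule map_image_inv_eq_iff[OF assms])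
  then show ?thesis by (simp add: tabloid_action_def polytabloid_def)
qed

lemma polytabloid_column_transpose:
  assumes t: "bij_betw t (young_diagram r) {1..n}"
    and b: "b \<in> young_diagram r" "b' \<in> young_diagram r" "snd b = snd b'" "b \<noteq> b'"
  shows "tabloid_action (transpose (t b) (t b')) (polytabloid n r t) X = - polytabloid n r t X"
  unfolding tabloid_action_polytabloid[OF bij_transpose]
  using sum_column_stabilizer_transpose[OF assms, of "\<lambda>q. if tabloid_of r (q \<circ> t) = X then 1 else 0"]
  by (simp add: polytabloid_def)

lemma partition_first_row:
  assumes "partition_of n r" "b \<in> young_diagram r"
  shows "(0, snd b) \<in> young_diagram r"
proof -
  obtain i j where b: "b = (i, j)" "i < length r" "j < r ! i" using assms(2) by (auto simp: young_diagram_def)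
  have "r ! i \<le> r ! 0"
    using assms(1) b(2) sorted_wrt_nth_less[of "(\<ge>)" r 0 i] by (cases "i = 0") (auto simp: partition_of_def)
  then show ?thesis using b by (auto simp: young_diagram_def)
qed

text \<open>The Garnir relation between the column of \<open>b\<close> and a column with the single
  box \<open>b'\<close>. That box lies in row 0, so its entry can be exchanged with the top entry of
  the other column without changing the tabloid.\<close>

lemma garnir_singleton_column:
  assumes part: "partition_of n r" and t: "bij_betw t (young_diagram r) {1..n}"
    and b: "b \<in> young_diagram r" and b': "b' \<in> young_diagram r" "snd b \<noteq> snd b'"
    and single: "{c \<in> young_diagram r. snd c = snd b'} = {b'}"
  shows "polytabloid n r t X =
    (\<Sum>x \<in> t ` {c \<in> young_diagram r. snd c = snd b}. tabloid_action (transpose x (t b')) (polytabloid n r t) X)"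
proof -
  let ?D = "young_diagram r" and ?C = "column_stabilizer n r t"
  define A where "A = t ` {c \<in> ?D. snd c = snd b}"
  define y where "y = t b'"
  define top where "top q = q (t (0, snd b))" for q :: "nat \<Rightarrow> nat"
  define I where "I Z = (if tabloid_of r Z = X then 1 else (0 :: complex))" for Z
  define F where "F x q = of_int (sign q) * I (transpose x y \<circ> q \<circ> t)" for x q
  have injt: "inj_on t ?D" using t by (simp add: bij_betw_def)
  have tD: "t c \<in> {1..n}" if "c \<in> ?D" for c using t that by (auto simp: bij_betw_def)
  have D0: "(0, snd b) \<in> ?D" by (rule partition_first_row[OF part b])
  have b'0: "fst b' = 0"
  proof -
    have "(0, snd b') \<in> {c \<in> ?D. snd c = snd b'}" using partition_first_row[OF part b'(1)] by simp
    then show ?thesis unfolding single by (metis fst_conv singletonD)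
  qed
  have fix_y: "q y = y" if "q \<in> ?C" for q
    using column_stabilizer_image[OF that b'(1)] single by (simp add: y_def)
  have finA: "finite A"
  proof -
    have "A \<subseteq> {1..n}" using tD by (auto simp: A_def)
    then show ?thesis using finite_subset by blast
  qed
  have A: "x \<in> {1..n}" "x \<noteq> y" if "x \<in> A" for x
    using that tD b' injt unfolding A_def y_def by (auto dest: inj_onD)
  have qA: "q x \<in> A" if "q \<in> ?C" "x \<in> A" for q x
    using that column_stabilizer_image[OF that(1)] unfolding A_def by force
  have topA: "top q \<in> A" if "q \<in> ?C" for q
    using column_stabilizer_image[OF that D0] by (simp add: top_def A_def)
  have injq: "inj_on (p \<circ> q \<circ> t) ?D" if "q \<in> ?C" "inj p" for p q
  proof -
    have "inj q" using column_stabilizer_permutes[OF that(1)] by (rule permutes_inj)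
    then have "inj (p \<circ> q)" using that(2) by (rule inj_compose[rotated])
    then show ?thesis by (intro comp_inj_on[OF injt]) (rule inj_on_subset, auto)
  qed
  have swapA: "transpose x z \<in> ?C" if xz: "x \<in> A" "z \<in> A" for x z
  proof -
    obtain c c' where "x = t c" "z = t c'" "c \<in> ?D" "c' \<in> ?D" "snd c = snd b" "snd c' = snd b"
      using xz unfolding A_def by blast
    then show ?thesis using transpose_in_column_stabilizer[OF t] by simp
  qed
  have top_term: "F (top q) q = of_int (sign q) * I (q \<circ> t)" if q: "q \<in> ?C" for q
  proof -
    have "tabloid_of r (transpose ((q \<circ> t) (0, snd b)) ((q \<circ> t) b') \<circ> (q \<circ> t)) = tabloid_of r (q \<circ> t)"
      by (rule tabloid_of_transpose_row[OF _ D0 b'(1)])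
        (use injq[OF q inj_on_id] b'0 in \<open>simp_all only: id_comp fst_conv\<close>)
    then show ?thesis using fix_y[OF q] by (simp add: F_def I_def top_def y_def comp_assoc)
  qed
  have swap_term: "F (top q) (transpose x (top q) \<circ> q) = - F x q" if q: "q \<in> ?C" and x: "x \<in> A" "x \<noteq> top q" for q x
  proof -
    define u where "u = transpose x y \<circ> q \<circ> t"
    have z: "top q \<in> A" by (rule topA[OF q])
    have u1: "u (0, snd b) = top q" using x z A by (simp add: u_def top_def transpose_def)
    have u2: "u b' = x" using fix_y[OF q] by (simp add: u_def y_def)
    \<comment> \<open>With z = \<open>top q\<close> this is (z y)(x z) = (x z)(x y). Since
      \<open>u\<close> has z and x in row 0, the factor (x z) does not affect the tabloid.\<close>
    have "transpose (top q) y \<circ> (transpose x (top q) \<circ> q) \<circ> t = transpose x (top q) \<circ> u"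
      using x z A by (auto simp: u_def fun_eq_iff transpose_def)
    moreover have "tabloid_of r (transpose (u b') (u (0, snd b)) \<circ> u) = tabloid_of r u"
      by (rule tabloid_of_transpose_row[OF _ b'(1) D0])
        (use injq[OF q bij_is_inj[OF bij_transpose]] b'0 in \<open>simp_all only: u_def fst_conv\<close>)
    ultimately have "I (transpose (top q) y \<circ> (transpose x (top q) \<circ> q) \<circ> t) = I u"
      by (simp add: I_def u1 u2)
    then show ?thesis
      using sign_transpose_comp[OF finite_atLeastAtMost column_stabilizer_permutes[OF q] x(2)]
      by (simp add: F_def u_def)
  qed
  text \<open>
    The entry of the column in row 0 of \<open>q \<circ> t\<close> yields the term of \<open>q\<close> in the polytabloid; the
    other terms cancel in pairs under a sign-reversing involution.
  \<close>
  define P where "P = (SIGMA q:?C. A - {top q})"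
  define i where "i = (\<lambda>(q, x). (transpose x (top q) \<circ> q, top q))"
  have i_mem: "i z \<in> P" and i_i: "i (i z) = z" if "z \<in> P" for z
  proof -
    obtain q x where z: "z = (q, x)" "q \<in> ?C" "x \<in> A" "x \<noteq> top q" using \<open>z \<in> P\<close> by (auto simp: P_def)
    have nt: "top (transpose x (top q) \<circ> q) = x" using z(4) by (simp add: top_def)
    show "i z \<in> P"
      using z nt topA[OF z(2)] swapA[OF z(3) topA[OF z(2)]] column_stabilizer_comp
      by (auto simp: i_def P_def)
    show "i (i z) = z" using nt by (simp add: i_def z(1) transpose_commute comp_assoc[symmetric])
  qed
  have "(\<Sum>z\<in>P. F (snd z) (fst z)) = (\<Sum>z\<in>P. F (snd (i z)) (fst (i z)))"
    by (rule sum.reindex_bij_witness[of _ i i]) (auto simp: i_mem i_i)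
  also have "\<dots> = (\<Sum>z\<in>P. - F (snd z) (fst z))"
    by (intro sum.cong refl) (auto simp: i_def P_def intro: swap_term)
  finally have "(\<Sum>z\<in>P. F (snd z) (fst z)) = 0" by (simp add: sum_negf)
  then have rest: "(\<Sum>q\<in>?C. \<Sum>x\<in>A - {top q}. F x q) = 0"
    using finA finite_column_stabilizer by (simp add: P_def sum.Sigma split_def)
  have "(\<Sum>x\<in>A. tabloid_action (transpose x y) (polytabloid n r t) X) = (\<Sum>x\<in>A. \<Sum>q\<in>?C. F x q)"
    by (simp add: tabloid_action_polytabloid F_def I_def)
  also have "\<dots> = (\<Sum>q\<in>?C. \<Sum>x\<in>A. F x q)" by (rule sum.swap)
  also have "\<dots> = (\<Sum>q\<in>?C. F (top q) q + (\<Sum>x\<in>A - {top q}. F x q))"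
    by (intro sum.cong refl sum.remove finA topA)
  also have "\<dots> = polytabloid n r t X"
    using rest top_term by (simp add: sum.distrib polytabloid_def I_def)
  finally show ?thesis by (simp add: A_def y_def)
qed

section \<open>Pairings with translated polytabloids\<close>

text \<open>The bilinear pairing of \<open>f\<close> with the translate by \<open>p\<close> of the
  polytabloid of \<open>t\<close>, regarded as a function of \<open>p\<close>. It is expanded over
  the column stabilizer, so no sum over tabloids occurs.\<close>

definition tabloid_pairing :: "nat \<Rightarrow> nat list \<Rightarrow> (nat \<times> nat \<Rightarrow> nat) \<Rightarrow> (tabloid \<Rightarrow> complex) \<Rightarrow> (nat \<Rightarrow> nat) \<Rightarrow> complex" where
  "tabloid_pairing n r t f p = (\<Sum>q\<in>column_stabilizer n r t. of_int (sign q) * f (tabloid_of r (p \<circ> q \<circ> t)))"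

lemma tabloid_pairing_action:
  "tabloid_pairing n r t (tabloid_action (transpose i j) f) p = tabloid_pairing n r t f (transpose i j \<circ> p)"
  by (simp add: tabloid_pairing_def tabloid_action_def tabloid_of_comp inv_swap_id comp_assoc)

lemma tabloid_pairing_alternating:
  assumes t: "bij_betw t (young_diagram r) {1..n}"
  shows "alternating_on {1..n} (t ` first_column r) (tabloid_pairing n r t f)"
  unfolding alternating_on_def
proof (intro conjI allI impI)
  show "t ` first_column r \<subseteq> {1..n}" using t by (auto simp: first_column_def bij_betw_def)
  fix p y z assume "y \<in> t ` first_column r" "z \<in> t ` first_column r" "y \<noteq> z"
  then obtain b b' where b: "y = t b" "z = t b'" "b \<in> first_column r" "b' \<in> first_column r" by blast
  have D: "b \<in> young_diagram r" "b' \<in> young_diagram r" "snd b = snd b'" "b \<noteq> b'"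
    using b \<open>y \<noteq> z\<close> by (auto simp: first_column_def)
  show "tabloid_pairing n r t f (p \<circ> transpose y z) = - tabloid_pairing n r t f p"
    using sum_column_stabilizer_transpose[OF t D, of "\<lambda>q. f (tabloid_of r (p \<circ> q \<circ> t))"]
    by (simp add: tabloid_pairing_def b(1,2) comp_assoc)
qed

lemma finite_tableaux: "finite (tableaux n r)"
proof (cases "tableaux n r = {}")
  case False
  then obtain t where "bij_betw t (young_diagram r) {1..n}" by (auto simp: tableaux_def)
  then have "finite (young_diagram r)" using bij_betw_finite by blast
  then have "finite (young_diagram r \<rightarrow>\<^sub>E {1..n})" by (intro finite_PiE) auto
  moreover have "tableaux n r \<subseteq> young_diagram r \<rightarrow>\<^sub>E {1..n}"
    by (auto simp: tableaux_def PiE_def bij_betw_def)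
  ultimately show ?thesis using finite_subset by blast
qed simp

lemma polytabloid_in_specht_module:
  assumes "t \<in> tableaux n r"
  shows "polytabloid n r t \<in> specht_module n r"
proof -
  have "polytabloid n r t = (\<lambda>X. \<Sum>t'\<in>tableaux n r. (if t' = t then 1 else 0) * polytabloid n r t' X)"
    using assms finite_tableaux by (auto simp: if_distrib[of "\<lambda>x. x * _"] cong: if_cong)
  then show ?thesis unfolding specht_module_def by (rule range_eqI[of _ _ "\<lambda>t'. if t' = t then 1 else 0"])
qed

text \<open>\<open>f\<close> is a combination of polytabloids, which have real values, so the
  squared norm of \<open>f\<close> is a combination of its pairings with them.\<close>

lemma specht_module_pairing_nonzero:
  assumes f: "f \<in> specht_module n r" "f \<noteq> (\<lambda>X. 0)"
  obtains t where "t \<in> tableaux n r" "tabloid_pairing n r t f id \<noteq> 0"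
proof -
  obtain c where c: "f = (\<lambda>X. \<Sum>t\<in>tableaux n r. c t * polytabloid n r t X)" using f(1) by (auto simp: specht_module_def)
  \<comment> \<open>A finite set of tabloids containing the support of \<open>f\<close>, over which
    inner products can be summed.\<close>
  define \<X> where "\<X> = (\<Union>t\<in>tableaux n r. (\<lambda>q. tabloid_of r (q \<circ> t)) ` column_stabilizer n r t)"
  have fin: "finite \<X>" using finite_tableaux finite_column_stabilizer by (simp add: \<X>_def)
  have supp: "f X = 0" if X: "X \<notin> \<X>" for X
  proof -
    have "polytabloid n r t X = 0" if "t \<in> tableaux n r" for t
      unfolding polytabloid_def
    proof (rule sum.neutral, rule ballI)
      fix q assume "q \<in> column_stabilizer n r t"
      then have "tabloid_of r (q \<circ> t) \<in> \<X>" using that by (auto simp: \<X>_def)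
      then show "of_int (sign q) * (if tabloid_of r (q \<circ> t) = X then 1 else 0) = (0 :: complex)" using X by auto
    qed
    then show ?thesis by (simp add: c)
  qed
  have cnj_poly: "cnj (polytabloid n r t X) = polytabloid n r t X" for t X
    by (auto simp: polytabloid_def intro!: sum.cong)
  have pair: "(\<Sum>X\<in>\<X>. f X * polytabloid n r t X) = tabloid_pairing n r t f id" if t: "t \<in> tableaux n r" for t
  proof -
    have "(\<Sum>X\<in>\<X>. f X * polytabloid n r t X) = (\<Sum>q\<in>column_stabilizer n r t. of_int (sign q) *
        (\<Sum>X\<in>\<X>. if tabloid_of r (q \<circ> t) = X then f X else 0))"
      unfolding polytabloid_def sum_distrib_left
      by (subst sum.swap) (intro sum.cong refl, auto)
    also have "\<dots> = tabloid_pairing n r t f id"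
      unfolding tabloid_pairing_def using fin t by (intro sum.cong refl) (auto simp: \<X>_def)
    finally show ?thesis .
  qed
  have "(\<Sum>X\<in>\<X>. f X * cnj (f X)) = (\<Sum>X\<in>\<X>. \<Sum>t\<in>tableaux n r. cnj (c t) * (f X * polytabloid n r t X))"
  proof (rule sum.cong[OF refl])
    fix X
    have "cnj (f X) = (\<Sum>t\<in>tableaux n r. cnj (c t) * polytabloid n r t X)"
      by (simp add: c cnj_poly)
    then show "f X * cnj (f X) = (\<Sum>t\<in>tableaux n r. cnj (c t) * (f X * polytabloid n r t X))"
      by (simp add: sum_distrib_left mult_ac)
  qed
  also have "\<dots> = (\<Sum>t\<in>tableaux n r. cnj (c t) * (\<Sum>X\<in>\<X>. f X * polytabloid n r t X))"
    by (subst sum.swap) (simp add: sum_distrib_left)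
  also have "\<dots> = (\<Sum>t\<in>tableaux n r. cnj (c t) * tabloid_pairing n r t f id)"
    by (intro sum.cong refl) (simp add: pair)
  finally have eq: "(\<Sum>X\<in>\<X>. f X * cnj (f X)) = (\<Sum>t\<in>tableaux n r. cnj (c t) * tabloid_pairing n r t f id)" .
  have "\<exists>t\<in>tableaux n r. tabloid_pairing n r t f id \<noteq> 0"
  proof (rule ccontr)
    assume "\<not> ?thesis"
    then have "(\<Sum>X\<in>\<X>. f X * cnj (f X)) = 0" using eq by (simp add: sum.neutral)
    then have "(\<Sum>X\<in>\<X>. (cmod (f X))\<^sup>2) = 0"
      by (simp only: complex_norm_square[symmetric] of_real_sum[symmetric] of_real_eq_0_iff)
    then have "f X = 0" if "X \<in> \<X>" for X using fin that by (simp add: sum_nonneg_eq_0_iff)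
    then show False using supp f(2) by blast
  qed
  then show ?thesis using that by blast
qed

section \<open>Vectors of a Specht module\<close>

locale specht_isomorphism =
  fixes n :: nat and \<rho> :: rep and r :: "nat list" and T :: "complex vec \<Rightarrow> tabloid \<Rightarrow> complex"
  assumes rep: "representation n \<rho>"
    and part: "partition_of n r"
    and bij: "bij_betw T (carrier_vec (degree_rep \<rho>)) (specht_module n r)"
    and add: "\<And>v w. v \<in> carrier_vec (degree_rep \<rho>) \<Longrightarrow> w \<in> carrier_vec (degree_rep \<rho>) \<Longrightarrow>
      T (v + w) = (\<lambda>X. T v X + T w X)"
    and smult: "\<And>c v. v \<in> carrier_vec (degree_rep \<rho>) \<Longrightarrow> T (c \<cdot>\<^sub>v v) = (\<lambda>X. c * T v X)"
    and equivariant: "\<And>p v. p permutes {1..n} \<Longrightarrow> v \<in> carrier_vec (degree_rep \<rho>) \<Longrightarrow>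
      T (\<rho> p *\<^sub>v v) = tabloid_action p (T v)"
begin

abbreviation d :: nat where "d \<equiv> degree_rep \<rho>"

lemma zero: "T (0\<^sub>v d) = (\<lambda>X. 0)"
proof -
  have "0 \<cdot>\<^sub>v 0\<^sub>v d = (0\<^sub>v d :: complex vec)" by (intro eq_vecI) auto
  then show ?thesis using smult[of "0\<^sub>v d" 0] by simp
qed

lemma eqI:
  assumes "v \<in> carrier_vec d" "w \<in> carrier_vec d" "T v = T w"
  shows "v = w"
  using assms bij by (auto simp: bij_betw_def dest: inj_onD)

lemma sum:
  assumes "finite E" "\<And>x. x \<in> E \<Longrightarrow> u x \<in> carrier_vec d"
  shows "T (vec d (\<lambda>l. \<Sum>x\<in>E. u x $ l)) X = (\<Sum>x\<in>E. T (u x) X)"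
  using assms
proof (induction E)
  case empty
  have "vec d (\<lambda>l. 0) = (0\<^sub>v d :: complex vec)" by auto
  then show ?case using zero by simp
next
  case (insert x E)
  have "vec d (\<lambda>l. \<Sum>x\<in>insert x E. u x $ l) = u x + vec d (\<lambda>l. \<Sum>x\<in>E. u x $ l)"
    using insert by (intro eq_vecI) (auto simp: carrier_vecD)
  then show ?case using insert add[of "u x" "vec d (\<lambda>l. \<Sum>x\<in>E. u x $ l)"] by simp
qed

lemma diff:
  assumes "v \<in> carrier_vec d" "w \<in> carrier_vec d"
  shows "T (v - w) X = T v X - T w X"
proof -
  have "v - w = v + (-1) \<cdot>\<^sub>v w" using assms by (intro eq_vecI) auto
  then show ?thesis using assms by (simp add: add smult)
qed

text \<open>The pairing turns the action on \<open>T v\<close> into left multiplication of the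
  argument, so the Laplacian of \<open>\<rho>\<close> becomes the one on functions of
  permutations.\<close>

lemma laplacian_pairing:
  assumes v: "v \<in> carrier_vec d"
  shows "tabloid_pairing n r t (T (laplacian n a \<rho> *\<^sub>v v)) p =
    (\<Sum>(i, j)\<in>edges n. complex_of_real (a i j) *
       (tabloid_pairing n r t (T v) p - tabloid_pairing n r t (T v) (transpose i j \<circ> p)))"
proof -
  define u where "u z = (case z of (i, j) \<Rightarrow> complex_of_real (a i j) \<cdot>\<^sub>v (v - \<rho> (transpose i j) *\<^sub>v v))" for z
  have C: "\<rho> (transpose i j) *\<^sub>v v \<in> carrier_vec d" if "(i, j) \<in> edges n" for i j
    using edgesD[OF that] by (intro representation_vec_carrier[OF rep _ v] permutes_swap_id) auto
  have uC: "u z \<in> carrier_vec d" if "z \<in> edges n" for z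
    using that C v by (cases z) (auto simp: u_def)
  have "laplacian n a \<rho> *\<^sub>v v = vec d (\<lambda>l. \<Sum>z\<in>edges n. u z $ l)"
  proof (intro eq_vecI)
    fix l assume "l < dim_vec (vec d (\<lambda>l. \<Sum>z\<in>edges n. u z $ l))"
    then have l: "l < d" by simp
    have "(\<Sum>z\<in>edges n. u z $ l) =
      (\<Sum>(i, j)\<in>edges n. complex_of_real (a i j) * (v $ l - (\<rho> (transpose i j) *\<^sub>v v) $ l))"
    proof (rule sum.cong[OF refl])
      fix z assume z: "z \<in> edges n"
      obtain i j where ij: "z = (i, j)" by (cases z)
      show "u z $ l = (case z of (i, j) \<Rightarrow> complex_of_real (a i j) * (v $ l - (\<rho> (transpose i j) *\<^sub>v v) $ l))"
        using C[of i j] z v l carrier_vecD[OF C[of i j]] unfolding ij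
        by (simp add: u_def del: index_mult_mat_vec)
    qed
    then show "(laplacian n a \<rho> *\<^sub>v v) $ l = vec d (\<lambda>l. \<Sum>z\<in>edges n. u z $ l) $ l"
      using l by (simp only: laplacian_mult_vec_index[OF rep v l] index_vec)
  qed (simp add: laplacian_def)
  then have "T (laplacian n a \<rho> *\<^sub>v v) X = (\<Sum>z\<in>edges n. T (u z) X)" for X
    using sum[OF finite_edges uC] by simp
  moreover have "T (u (i, j)) X = complex_of_real (a i j) * (T v X - tabloid_action (transpose i j) (T v) X)"
    if e: "(i, j) \<in> edges n" for i j X
  proof -
    have t: "transpose i j permutes {1..n}" using edgesD[OF e] by (intro permutes_swap_id) auto
    have "v - \<rho> (transpose i j) *\<^sub>v v \<in> carrier_vec d" using v C[OF e] by simp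
    then show ?thesis using v C[OF e] by (simp add: u_def smult diff equivariant[OF t v])
  qed
  ultimately have T: "T (laplacian n a \<rho> *\<^sub>v v) X =
    (\<Sum>(i, j)\<in>edges n. complex_of_real (a i j) * (T v X - tabloid_action (transpose i j) (T v) X))" for X
    by (auto intro!: sum.cong)
  let ?C = "column_stabilizer n r t"
  have "tabloid_pairing n r t (T (laplacian n a \<rho> *\<^sub>v v)) p = (\<Sum>(i, j)\<in>edges n. \<Sum>q\<in>?C.
     of_int (sign q) * (complex_of_real (a i j) * (T v (tabloid_of r (p \<circ> q \<circ> t))
       - tabloid_action (transpose i j) (T v) (tabloid_of r (p \<circ> q \<circ> t)))))"
    unfolding tabloid_pairing_def T sum_distrib_left by (subst sum.swap) (auto intro!: sum.cong)
  also have "\<dots> = (\<Sum>(i, j)\<in>edges n. complex_of_real (a i j) *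
       (tabloid_pairing n r t (T v) p - tabloid_pairing n r t (tabloid_action (transpose i j) (T v)) p))"
    by (rule sum_pair_cong) (simp add: tabloid_pairing_def sum_distrib_left sum_subtractf[symmetric] algebra_simps)
  finally show ?thesis by (simp only: tabloid_pairing_action)
qed

lemma pairing_nonzero:
  assumes v: "v \<in> carrier_vec d" "v \<noteq> 0\<^sub>v d"
  obtains t where "t \<in> tableaux n r" "tabloid_pairing n r t (T v) id \<noteq> 0"
proof -
  have "T v \<in> specht_module n r" using bij v(1) by (auto simp: bij_betw_def)
  moreover have "T v \<noteq> (\<lambda>X. 0)" using eqI[OF v(1), of "0\<^sub>v d"] zero v(2) by auto
  ultimately show ?thesis using specht_module_pairing_nonzero that by blast
qed

text \<open>If all polytabloids vanished, the Specht module would be zero, contrary to positive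
  degree.\<close>

lemma ex_nonzero_polytabloid:
  assumes "d > 0"
  obtains t where "t \<in> tableaux n r" "polytabloid n r t \<noteq> (\<lambda>X. 0)"
proof -
  have "\<exists>t\<in>tableaux n r. polytabloid n r t \<noteq> (\<lambda>X. 0)"
  proof (rule ccontr)
    assume neg: "\<not> ?thesis"
    have "T (unit_vec d 0) \<in> specht_module n r" using bij by (auto simp: bij_betw_def)
    then obtain c where "T (unit_vec d 0) = (\<lambda>X. \<Sum>t\<in>tableaux n r. c t * polytabloid n r t X)"
      by (auto simp: specht_module_def)
    then have "T (unit_vec d 0) = T (0\<^sub>v d)" using neg by (simp add: zero sum.neutral)
    then have "unit_vec d 0 = (0\<^sub>v d :: complex vec)" by (intro eqI) auto
    then have "unit_vec d 0 $ 0 = (0\<^sub>v d :: complex vec) $ 0" by simp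
    then show False using assms by simp
  qed
  then show ?thesis using that by blast
qed

section \<open>A test vector from a polytabloid\<close>

text \<open>\<open>v\<close> corresponds to a nonzero polytabloid, and \<open>h x\<close> is
  \<open>1 - 1 / c\<close> with \<open>c\<close> the length of the column that contains the entry
  \<open>x\<close>. Thus \<open>h x = 0\<close> says that \<open>x\<close> is alone in its column.
  The rates serve the eigenvalue bound, the last property serves non-isomorphism.\<close>

lemma polytabloid_vector:
  assumes u: "unitary_rep n \<rho>" and d: "d > 0"
  obtains v h where "v \<in> carrier_vec d" "v \<noteq> 0\<^sub>v d"
    "\<And>x. x \<in> {1..n} \<Longrightarrow> h x = 0 \<or> h x \<ge> (1/2 :: real)"
    "(\<Sum>x\<in>{1..n}. h x) \<le> real n - card (first_row r)"
    "\<And>i j. i \<in> {1..n} \<Longrightarrow> j \<in> {1..n} \<Longrightarrow> i \<noteq> j \<Longrightarrow> h j = 0 \<Longrightarrow>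
      Re ((\<rho> (transpose i j) *\<^sub>v v) \<bullet>c v) = (1 - h i) * sqnorm v"
    "\<And>i j. i \<in> {1..n} \<Longrightarrow> j \<in> {1..n} \<Longrightarrow> i \<noteq> j \<Longrightarrow> h i = 0 \<Longrightarrow> h j = 0 \<Longrightarrow>
      \<rho> (transpose i j) *\<^sub>v v = v"
proof -
  let ?D = "young_diagram r"
  obtain t where t: "t \<in> tableaux n r" "polytabloid n r t \<noteq> (\<lambda>X. 0)" using ex_nonzero_polytabloid[OF d] .
  have bt: "bij_betw t ?D {1..n}" using t(1) by (simp add: tableaux_def)
  have finD: "finite ?D" using bij_betw_finite[OF bt] by simp
  have injt: "inj_on t ?D" using bt by (simp add: bij_betw_def)
  obtain v where v: "v \<in> carrier_vec d" "T v = polytabloid n r t"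
    using bij polytabloid_in_specht_module[OF t(1)] by (metis bij_betw_imp_surj_on imageE)
  have v0: "v \<noteq> 0\<^sub>v d" using v(2) t(2) zero by auto
  define col where "col b = {c \<in> ?D. snd c = snd b}" for b :: "nat \<times> nat"
  define h where "h x = 1 - 1 / real (card (col (inv_into ?D t x)))" for x
  have ht: "h (t b) = 1 - 1 / real (card (col b))" if "b \<in> ?D" for b
    using that injt by (simp add: h_def)
  have fincol: "finite (col b)" for b using finD by (simp add: col_def)
  have colb: "b \<in> col b" if "b \<in> ?D" for b using that by (simp add: col_def)
  have box: "\<exists>b\<in>?D. x = t b" if "x \<in> {1..n}" for x using bt that by (auto simp: bij_betw_def)
  have card_col: "card (col b) > 0" if "b \<in> ?D" for b
    using colb[OF that] fincol[of b] by (auto simp: card_gt_0_iff)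
  have h_half: "h x = 0 \<or> h x \<ge> 1/2" if x: "x \<in> {1..n}" for x
  proof -
    obtain b where b: "b \<in> ?D" "x = t b" using box[OF x] by blast
    have "card (col b) = 1 \<or> card (col b) \<ge> 2" using card_col[OF b(1)] by linarith
    then show ?thesis unfolding b(2) ht[OF b(1)] by (auto simp: field_simps)
  qed
  have h_zero: "col b = {b}" if "b \<in> ?D" "h (t b) = 0" for b
  proof -
    have "card (col b) = 1" using that card_col[OF that(1)] by (simp add: ht)
    then show ?thesis using colb[OF that(1)] by (metis card_1_singletonE singletonD)
  qed
  \<comment> \<open>Reciprocal column lengths add up to 1 over each column, so the sum of
    \<open>h\<close> is \<open>n\<close> minus the number of columns.\<close>
  have h_sum: "(\<Sum>x\<in>{1..n}. h x) \<le> real n - card (first_row r)"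
  proof -
    have "(\<Sum>x\<in>{1..n}. h x) = (\<Sum>b\<in>?D. h (t b))" by (rule sum.reindex_bij_betw[OF bt, symmetric])
    also have "\<dots> = (\<Sum>b\<in>?D. 1 - 1 / real (card (col b)))" by (intro sum.cong refl) (rule ht)
    also have "\<dots> = real (card ?D) - (\<Sum>b\<in>?D. 1 / real (card (col b)))" by (simp add: sum_subtractf)
    also have "card ?D = n" using bij_betw_same_card[OF bt] by simp
    also have "(\<Sum>b\<in>?D. 1 / real (card (col b))) = (\<Sum>j\<in>snd ` ?D. \<Sum>b\<in>{b \<in> ?D. snd b = j}. 1 / real (card (col b)))"
      by (rule sum.image_gen[OF finD])
    also have "\<dots> = (\<Sum>j\<in>snd ` ?D. 1)"
    proof (intro sum.cong refl)
      fix j assume "j \<in> snd ` ?D"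
      then obtain b where b: "b \<in> ?D" "snd b = j" by auto
      have "(\<Sum>c\<in>{c \<in> ?D. snd c = j}. 1 / real (card (col c))) = (\<Sum>c\<in>col b. 1 / real (card (col b)))"
        using b by (intro sum.cong) (auto simp: col_def)
      then show "(\<Sum>c\<in>{c \<in> ?D. snd c = j}. 1 / real (card (col c))) = 1" using card_col[OF b(1)] by simp
    qed
    also have "\<dots> = real (card (snd ` ?D))" by simp
    finally have *: "(\<Sum>x\<in>{1..n}. h x) = real n - real (card (snd ` ?D))" .
    have "inj_on snd (first_row r)" by (auto simp: inj_on_def first_row_def)
    then have "card (first_row r) = card (snd ` first_row r)" by (simp add: card_image)
    also have "\<dots> \<le> card (snd ` ?D)" using finD by (intro card_mono) (auto simp: first_row_def)
    finally show ?thesis using * by simp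
  qed
  have C: "\<rho> (transpose i j) *\<^sub>v v \<in> carrier_vec d" if "i \<in> {1..n}" "j \<in> {1..n}" for i j
    using that by (intro representation_vec_carrier[OF rep _ v(1)] permutes_swap_id)
  have tD: "t b \<in> {1..n}" if "b \<in> ?D" for b using bt that by (auto simp: bij_betw_def)
  have Tv: "T (\<rho> (transpose i j) *\<^sub>v v) = tabloid_action (transpose i j) (polytabloid n r t)"
    if "i \<in> {1..n}" "j \<in> {1..n}" for i j
    using equivariant[OF permutes_swap_id[OF that] v(1)] v(2) by simp
  have garnir: "v = vec d (\<lambda>l. \<Sum>x\<in>t ` col b. (\<rho> (transpose x (t b')) *\<^sub>v v) $ l)"
    if b: "b \<in> ?D" "b' \<in> ?D" "b \<noteq> b'" "h (t b') = 0" for b b'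
  proof (rule eqI[OF v(1)])
    have colD: "x \<in> {1..n}" if "x \<in> t ` col b" for x using that tD by (auto simp: col_def)
    have single: "{c \<in> ?D. snd c = snd b'} = {b'}" using h_zero[OF b(2,4)] by (simp add: col_def)
    then have ne: "snd b \<noteq> snd b'" using b by auto
    have "T (vec d (\<lambda>l. \<Sum>x\<in>t ` col b. (\<rho> (transpose x (t b')) *\<^sub>v v) $ l)) X = T v X" for X
    proof -
      have "T (vec d (\<lambda>l. \<Sum>x\<in>t ` col b. (\<rho> (transpose x (t b')) *\<^sub>v v) $ l)) X
        = (\<Sum>x\<in>t ` col b. T (\<rho> (transpose x (t b')) *\<^sub>v v) X)"
        by (rule sum) (use fincol C colD tD b(2) in auto)
      also have "\<dots> = (\<Sum>x\<in>t ` col b. tabloid_action (transpose x (t b')) (polytabloid n r t) X)"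
        by (intro sum.cong refl) (simp only: Tv colD tD b(2))
      also have "\<dots> = polytabloid n r t X"
        using garnir_singleton_column[OF part bt b(1,2) ne single, of X] by (simp add: col_def)
      finally show ?thesis by (simp add: v(2))
    qed
    then show "T v = T (vec d (\<lambda>l. \<Sum>x\<in>t ` col b. (\<rho> (transpose x (t b')) *\<^sub>v v) $ l))" by (intro ext) simp
  qed simp
  \<comment> \<open>Here the column of \<open>b\<close> has one box as well, and the Garnir sum has
    a single term.\<close>
  have fixed: "\<rho> (transpose (t b) (t b')) *\<^sub>v v = v"
    if b: "b \<in> ?D" "b' \<in> ?D" "b \<noteq> b'" "h (t b) = 0" "h (t b') = 0" for b b'
  proof -
    have "v = vec d (\<lambda>l. (\<rho> (transpose (t b) (t b')) *\<^sub>v v) $ l)"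
      using garnir[OF b(1-3,5)] h_zero[OF b(1,4)] by simp
    also have "\<dots> = \<rho> (transpose (t b) (t b')) *\<^sub>v v"
      using C[OF tD[OF b(1)] tD[OF b(2)]] by (intro eq_vecI) (simp_all only: index_vec dim_vec carrier_vecD)
    finally show ?thesis by simp
  qed
  \<comment> \<open>The column transposition of \<open>t c\<close> and \<open>t b\<close> negates
    \<open>v\<close> and conjugates one edge to the other; the two signs cancel in the inner
    product.\<close>
  have same: "(\<rho> (transpose (t c) (t b')) *\<^sub>v v) \<bullet>c v = (\<rho> (transpose (t b) (t b')) *\<^sub>v v) \<bullet>c v"
    if b: "b \<in> ?D" "b' \<in> ?D" "b \<noteq> b'" "c \<in> col b" "c \<noteq> b'" for b b' c
  proof (cases "c = b")
    case False
    have c: "c \<in> ?D" "snd c = snd b" using b(4) by (auto simp: col_def)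
    define q where "q = transpose (t c) (t b)"
    have qp: "q permutes {1..n}" unfolding q_def using tD[OF c(1)] tD[OF b(1)] by (rule permutes_swap_id)
    have "T (\<rho> q *\<^sub>v v) = T ((-1) \<cdot>\<^sub>v v)"
      using polytabloid_column_transpose[OF bt c(1) b(1) c(2) False] Tv[OF tD[OF c(1)] tD[OF b(1)]]
      by (simp add: q_def smult v fun_eq_iff)
    then have q: "\<rho> q *\<^sub>v v = (-1) \<cdot>\<^sub>v v"
      using v(1) representation_vec_carrier[OF rep qp v(1)] by (intro eqI) auto
    have qt: "q (t c) = t b" "q (t b') = t b'"
      using inj_on_eq_iff[OF injt] b c by (auto simp: q_def transpose_def)
    have "(\<rho> (transpose (t c) (t b')) *\<^sub>v ((-1) \<cdot>\<^sub>v v)) \<bullet>c ((-1) \<cdot>\<^sub>v v)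
      = (\<rho> (transpose (t b) (t b')) *\<^sub>v v) \<bullet>c v"
      using unitary_rep_conj_transpose[OF u qp tD[OF c(1)] tD[OF b(2)] v(1)] q qt
      by (simp add: q_def)
    moreover have "\<rho> (transpose (t c) (t b')) \<in> carrier_mat d d"
      by (intro representation_carrier[OF rep] permutes_swap_id tD c b)
    ultimately show ?thesis
      using v(1) C[OF tD[OF c(1)] tD[OF b(2)]]
      by (simp add: mult_mat_vec[of _ d d] conjugate_smult_vec del: index_mult_mat_vec)
  qed simp
  \<comment> \<open>The inner product of the Garnir sum with \<open>v\<close> has
    \<open>card (col b)\<close> equal terms, so each is \<open>sqnorm v\<close> divided by the
    column length.\<close>
  have rate: "Re ((\<rho> (transpose i j) *\<^sub>v v) \<bullet>c v) = (1 - h i) * sqnorm v"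
    if ij: "i \<in> {1..n}" "j \<in> {1..n}" "i \<noteq> j" "h j = 0" for i j
  proof -
    obtain b b' where b: "b \<in> ?D" "i = t b" "b' \<in> ?D" "j = t b'" using box ij by metis
    have ne: "b \<noteq> b'" using ij b by auto
    have hb: "h (t b') = 0" using ij(4) b(4) by simp
    have ninc: "b' \<notin> col b"
    proof
      assume "b' \<in> col b"
      then have "b \<in> col b'" using b(1) by (simp add: col_def)
      then show False using h_zero[OF b(3) hb] ne by simp
    qed
    define w where "w x = \<rho> (transpose x j) *\<^sub>v v" for x
    have wC: "w x \<in> carrier_vec d" if "x \<in> t ` col b" for x
      using that tD ij C by (auto simp: w_def col_def)
    have vl: "v $ l = (\<Sum>x\<in>t ` col b. w x $ l)" if "l < d" for l
    proof -
      have "v = vec d (\<lambda>l. \<Sum>x\<in>t ` col b. w x $ l)"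
        unfolding w_def b(4) by (rule garnir[OF b(1,3) ne hb])
      then have "v $ l = vec d (\<lambda>l. \<Sum>x\<in>t ` col b. w x $ l) $ l" by (rule arg_cong[of _ _ "\<lambda>u. u $ l"])
      then show ?thesis using that by (simp only: index_vec)
    qed
    have "v \<bullet>c v = (\<Sum>l<d. v $ l * cnj (v $ l))"
      using v(1) by (simp add: scalar_prod_def lessThan_atLeast0)
    also have "\<dots> = (\<Sum>l<d. (\<Sum>x\<in>t ` col b. w x $ l) * cnj (v $ l))"
      by (intro sum.cong refl) (simp add: vl[symmetric])
    also have "\<dots> = (\<Sum>x\<in>t ` col b. \<Sum>l<d. w x $ l * cnj (v $ l))"
      unfolding sum_distrib_right by (rule sum.swap)
    also have "\<dots> = (\<Sum>x\<in>t ` col b. w x \<bullet>c v)"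
      using v(1) by (simp add: scalar_prod_def lessThan_atLeast0)
    also have "\<dots> = (\<Sum>x\<in>t ` col b. w i \<bullet>c v)"
    proof (intro sum.cong refl)
      fix x assume "x \<in> t ` col b"
      then obtain c where c: "x = t c" "c \<in> col b" by blast
      then show "w x \<bullet>c v = w i \<bullet>c v"
        using same[OF b(1,3) ne c(2)] ninc b by (auto simp: w_def)
    qed
    also have "\<dots> = of_nat (card (col b)) * (w i \<bullet>c v)"
      using injt by (subst sum_constant, subst card_image) (auto simp: col_def intro: inj_on_subset)
    finally have "sqnorm v = card (col b) * Re (w i \<bullet>c v)" by (simp add: sqnorm_def)
    moreover have "(1 - h i) * card (col b) = 1" using card_col[OF b(1)] ht[OF b(1)] b(2) by simp
    ultimately show ?thesis by (simp add: w_def mult.assoc[symmetric])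
  qed
  show ?thesis
  proof (rule that[OF v(1) v0 h_half h_sum rate])
    fix i j assume ij: "i \<in> {1..n}" "j \<in> {1..n}" "i \<noteq> j" "h i = 0" "h j = 0"
    obtain b b' where b: "b \<in> ?D" "i = t b" "b' \<in> ?D" "j = t b'" using box ij by metis
    show "\<rho> (transpose i j) *\<^sub>v v = v" using fixed[of b b'] b ij by auto
  qed
qed

end

lemma has_young_diagram_specht_isomorphism:
  assumes "has_young_diagram n \<rho> r"
  obtains T where "specht_isomorphism n \<rho> r T"
proof -
  obtain T where "bij_betw T (carrier_vec (degree_rep \<rho>)) (specht_module n r)"
    "\<forall>v \<in> carrier_vec (degree_rep \<rho>). \<forall>w \<in> carrier_vec (degree_rep \<rho>). T (v + w) = (\<lambda>X. T v X + T w X)"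
    "\<forall>c. \<forall>v \<in> carrier_vec (degree_rep \<rho>). T (c \<cdot>\<^sub>v v) = (\<lambda>X. c * T v X)"
    "\<forall>p \<in> carrier (sym_group n). \<forall>v \<in> carrier_vec (degree_rep \<rho>). T (\<rho> p *\<^sub>v v) = tabloid_action p (T v)"
    using assms unfolding has_young_diagram_def by blast
  then have "specht_isomorphism n \<rho> r T"
    using assms by unfold_locales (auto simp: has_young_diagram_def sym_group_carrier)
  then show ?thesis by (rule that)
qed

section \<open>Comparison\<close>

text \<open>Summation by parts: the terms of \<open>p\<close> and
  \<open>transpose i j \<circ> p\<close> add up to a squared modulus.\<close>

lemma sum_energy_eq_dirichlet:
  fixes g :: "('a \<Rightarrow> 'a) \<Rightarrow> complex"
  assumes "i \<in> S" "j \<in> S"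
  shows "(\<Sum>p | p permutes S. Re ((g p - g (transpose i j \<circ> p)) * cnj (g p))) = dirichlet S g i j"
proof -
  let ?e = "\<lambda>p :: 'a \<Rightarrow> 'a. transpose i j \<circ> p"
  have "2 * (\<Sum>p | p permutes S. Re ((g p - g (?e p)) * cnj (g p)))
      = (\<Sum>p | p permutes S. Re ((g p - g (?e p)) * cnj (g p)) + Re ((g (?e p) - g (?e (?e p))) * cnj (g (?e p))))"
    using sum_permutes_transpose_comp[OF assms, of "\<lambda>p. Re ((g p - g (?e p)) * cnj (g p))"]
    by (simp only: sum.distrib)
  also have "\<dots> = (\<Sum>p | p permutes S. (cmod (g p - g (?e p)))\<^sup>2)"
  proof (intro sum.cong refl)
    fix p :: "'a \<Rightarrow> 'a"
    have "?e (?e p) = p" by (simp add: comp_assoc[symmetric])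
    then show "Re ((g p - g (?e p)) * cnj (g p)) + Re ((g (?e p) - g (?e (?e p))) * cnj (g (?e p)))
      = (cmod (g p - g (?e p)))\<^sup>2"
      unfolding cmod_power2 by (simp only:) (simp add: power2_eq_square algebra_simps)
  qed
  finally show ?thesis by (simp add: dirichlet_def)
qed

lemma dirichlet_commute: "dirichlet S g i j = dirichlet S g j i"
  by (simp add: dirichlet_def transpose_commute)

context specht_isomorphism
begin

text \<open>\<open>g\<close> pairs an eigenvector with the translates of one polytabloid, and
  \<open>Y\<close> holds the labels of its first column. Multiplying the eigenvalue equation for
  \<open>g p\<close> by \<open>cnj (g p)\<close> and summing over \<open>p\<close> gives the energy
  identity.\<close>

lemma eigenvalue_alternating_function:
  assumes u: "unitary_rep n \<rho>" and ev: "eigenvalue (laplacian n a \<rho>) (complex_of_real x)"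
    and k: "card (first_column r) + k \<ge> n"
  obtains Y g where "alternating_function {1..n} Y g k" "g id \<noteq> 0"
    "x * (\<Sum>p | p permutes {1..n}. (cmod (g p))\<^sup>2) = (\<Sum>(i, j)\<in>edges n. a i j * dirichlet {1..n} g i j)"
proof -
  obtain v where v: "v \<in> carrier_vec d" "v \<noteq> 0\<^sub>v d" "laplacian n a \<rho> *\<^sub>v v = complex_of_real x \<cdot>\<^sub>v v"
    using ev by (auto simp: eigenvalue_def eigenvector_def laplacian_def)
  obtain t where t: "t \<in> tableaux n r" "tabloid_pairing n r t (T v) id \<noteq> 0" using pairing_nonzero[OF v(1,2)] .
  have bt: "bij_betw t (young_diagram r) {1..n}" using t(1) by (simp add: tableaux_def)
  define g where "g = tabloid_pairing n r t (T v)"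
  define Y where "Y = t ` first_column r"
  have alt: "alternating_on {1..n} Y g" unfolding Y_def g_def by (rule tabloid_pairing_alternating[OF bt])
  have "inj_on t (first_column r)" using bt by (auto simp: bij_betw_def first_column_def intro: inj_on_subset)
  then have "card Y = card (first_column r)" by (simp add: Y_def card_image)
  moreover have Y: "Y \<subseteq> {1..n}" using alt by (simp add: alternating_on_def)
  then have "card ({1..n} - Y) = n - card Y" by (simp add: card_Diff_subset finite_subset)
  ultimately have "card ({1..n} - Y) \<le> k" using k by simp
  then have af: "alternating_function {1..n} Y g k" using alt by unfold_locales auto
  have eig: "complex_of_real x * g p = (\<Sum>(i, j)\<in>edges n. complex_of_real (a i j) * (g p - g (transpose i j \<circ> p)))" for p
    unfolding g_def laplacian_pairing[OF v(1), symmetric] v(3) smult[OF v(1)]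
    by (simp add: tabloid_pairing_def sum_distrib_left mult_ac)
  have "x * (\<Sum>p | p permutes {1..n}. (cmod (g p))\<^sup>2)
      = (\<Sum>p | p permutes {1..n}. Re (complex_of_real x * g p * cnj (g p)))"
    unfolding sum_distrib_left cmod_power2 by (intro sum.cong refl) (simp add: power2_eq_square algebra_simps)
  also have "\<dots> = (\<Sum>p | p permutes {1..n}. \<Sum>(i, j)\<in>edges n.
      a i j * Re ((g p - g (transpose i j \<circ> p)) * cnj (g p)))"
    unfolding eig sum_distrib_right Re_sum
    by (intro sum.cong refl) (auto simp: algebra_simps)
  also have "\<dots> = (\<Sum>(i, j)\<in>edges n. a i j * (\<Sum>p | p permutes {1..n}. Re ((g p - g (transpose i j \<circ> p)) * cnj (g p))))"
    by (subst sum.swap, rule sum.cong[OF refl]) (simp only: sum_distrib_left case_prod_beta)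
  also have "\<dots> = (\<Sum>(i, j)\<in>edges n. a i j * dirichlet {1..n} g i j)"
    by (rule sum_pair_cong) (simp only: sum_energy_eq_dirichlet edgesD)
  finally show ?thesis using that[OF af] t(2) by (simp add: g_def)
qed

text \<open>Invariance under transpositions of \<open>U\<close> contradicts alternation in the
  first-column labels once the two sets share two points, which the size hypothesis forces.\<close>

lemma fixed_vector_eq_zero:
  assumes v: "v \<in> carrier_vec d" and U: "U \<subseteq> {1..n}" "card U + card (first_column r) \<ge> n + 2"
    and fixed: "\<And>i j. i \<in> U \<Longrightarrow> j \<in> U \<Longrightarrow> i \<noteq> j \<Longrightarrow> \<rho> (transpose i j) *\<^sub>v v = v"
  shows "v = 0\<^sub>v d"
proof (rule ccontr)
  assume "v \<noteq> 0\<^sub>v d"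
  then obtain t where t: "t \<in> tableaux n r" "tabloid_pairing n r t (T v) id \<noteq> 0" using pairing_nonzero[OF v] by blast
  have bt: "bij_betw t (young_diagram r) {1..n}" using t(1) by (simp add: tableaux_def)
  define g where "g = tabloid_pairing n r t (T v)"
  define Y where "Y = t ` first_column r"
  have alt: "alternating_on {1..n} Y g" unfolding Y_def g_def by (rule tabloid_pairing_alternating[OF bt])
  have "inj_on t (first_column r)" using bt by (auto simp: bij_betw_def first_column_def intro: inj_on_subset)
  then have cY: "card Y = card (first_column r)" by (simp add: Y_def card_image)
  have Y: "Y \<subseteq> {1..n}" using alt by (simp add: alternating_on_def)
  have fin: "finite U" "finite Y" using U(1) Y finite_subset by blast+
  have "card (U \<union> Y) \<le> n" using card_mono[of "{1..n}" "U \<union> Y"] U(1) Y by simp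
  then have c: "card (U \<inter> Y) \<ge> 2" using card_Un_Int[OF fin] U(2) cY by simp
  then obtain i j where ij: "i \<in> U \<inter> Y" "j \<in> U \<inter> Y" "i \<noteq> j"
    by (metis card_le_Suc0_iff_eq fin(1) finite_Int not_less_eq_eq numeral_2_eq_2)
  then have ij': "i \<in> {1..n}" "j \<in> {1..n}" using U(1) by auto
  have "g (transpose i j \<circ> id) = - g id"
    by (rule alternating_on_transpose_comp[OF alt permutes_id]) (use ij in auto)
  moreover have "tabloid_action (transpose i j) (T v) = T v"
    using equivariant[OF permutes_swap_id[OF ij'] v] fixed[of i j] ij by simp
  then have "g (transpose i j \<circ> id) = g id"
    using tabloid_pairing_action[of n r t i j "T v" id] by (simp add: g_def)
  ultimately have "g id = - g id" by (simp only:)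
  then show False using t(2) by (simp add: g_def)
qed

end

text \<open>\<open>V\<close> is chosen from an eigenvector of \<open>\<sigma>\<close>, and the test
  vectors of \<open>\<tau>\<close> are then averaged for this same \<open>V\<close>. The comparison
  is made edge by edge and summed with the nonnegative weights \<open>a\<close>.\<close>

lemma aldous_le_long_row_column:
  assumes k: "k \<ge> 1" and n: "n \<ge> 4 * k\<^sup>2 + 4 * k"
    and \<tau>: "unitary_rep n \<tau>" "degree_rep \<tau> > 0" "has_young_diagram n \<tau> r" "card (first_row r) \<ge> n - k"
    and \<sigma>: "unitary_rep n \<sigma>" "degree_rep \<sigma> > 0" "has_young_diagram n \<sigma> s" "card (first_column s) \<ge> n - k"
  shows "aldous_le n \<sigma> \<tau>"
  unfolding aldous_le_def
proof (intro allI impI)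
  fix a :: "nat \<Rightarrow> nat \<Rightarrow> real"
  assume a: "\<forall>i j. 1 \<le> i \<and> i < j \<and> j \<le> n \<longrightarrow> 0 \<le> a i j"
  obtain T where "specht_isomorphism n \<tau> r T" using has_young_diagram_specht_isomorphism[OF \<tau>(3)] .
  then interpret \<tau>: specht_isomorphism n \<tau> r T .
  obtain T' where "specht_isomorphism n \<sigma> s T'" using has_young_diagram_specht_isomorphism[OF \<sigma>(3)] .
  then interpret \<sigma>: specht_isomorphism n \<sigma> s T' .
  have cs: "card (first_column s) + k \<ge> n" using \<sigma>(4) by simp
  obtain Y g where g: "alternating_function {1..n} Y g k" "g id \<noteq> 0"
    "lambda1 n a \<sigma> * (\<Sum>p | p permutes {1..n}. (cmod (g p))\<^sup>2) = (\<Sum>(i, j)\<in>edges n. a i j * dirichlet {1..n} g i j)"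
    using \<sigma>.eigenvalue_alternating_function[OF \<sigma>(1) lambda1_eigenvalue[OF \<sigma>(1,2)] cs] .
  interpret alternating_function "{1..n}" Y g k by (rule g(1))
  \<comment> \<open>Positivity comes from \<open>g id \<noteq> 0\<close> and allows
    \<open>mass\<close> to be cancelled at the end.\<close>
  have mass: "mass > 0"
    unfolding mass_def using g(2) finP permutes_id[of "{1..n}"] by (intro sum_pos2[of _ id]) auto
  have nS: "card {1..n} \<ge> 4 * k\<^sup>2 + 4 * k" using n by simp
  obtain V where V: "V \<subseteq> {1..n}" "card V = card {1..n} - 4 * k"
    "\<And>i j. i \<in> V \<Longrightarrow> j \<in> V \<Longrightarrow> i \<noteq> j \<Longrightarrow> 4 * real k / card V * mass \<le> dirichlet {1..n} g i j"
    "\<And>i j. i \<in> V \<Longrightarrow> j \<in> {1..n} - V \<Longrightarrow> real k / card V * mass \<le> dirichlet {1..n} g i j"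
    by (rule dirichlet_lower_bound[OF k nS]) (rule that; assumption)
  have weight: "edge_weight k V i j * mass \<le> dirichlet {1..n} g i j"
    if "i \<in> {1..n}" "j \<in> {1..n}" "i \<noteq> j" for i j
    using V(3)[of i j] V(4)[of i j] V(4)[of j i] that dirichlet_commute[of "{1..n}" g i j]
    by (auto simp: edge_weight_def dirichlet_def sum_nonneg)
  have kk: "k \<le> k\<^sup>2" using k by (simp add: power2_eq_square)
  have cV: "card V \<ge> 4 * k\<^sup>2" using V(2) n by simp
  have V2k: "2 * k \<le> card V" and Vne: "V \<noteq> {}" using cV kk k by auto
  obtain v h where vh: "v \<in> carrier_vec (degree_rep \<tau>)" "v \<noteq> 0\<^sub>v (degree_rep \<tau>)"
    "\<And>x. x \<in> {1..n} \<Longrightarrow> h x = 0 \<or> h x \<ge> (1/2 :: real)"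
    "(\<Sum>x\<in>{1..n}. h x) \<le> real n - card (first_row r)"
    "\<And>i j. i \<in> {1..n} \<Longrightarrow> j \<in> {1..n} \<Longrightarrow> i \<noteq> j \<Longrightarrow> h j = 0 \<Longrightarrow>
      Re ((\<tau> (transpose i j) *\<^sub>v v) \<bullet>c v) = (1 - h i) * sqnorm v"
    "\<And>i j. i \<in> {1..n} \<Longrightarrow> j \<in> {1..n} \<Longrightarrow> i \<noteq> j \<Longrightarrow> h i = 0 \<Longrightarrow> h j = 0 \<Longrightarrow>
      \<tau> (transpose i j) *\<^sub>v v = v"
    by (rule \<tau>.polytabloid_vector[OF \<tau>(1,2)]) (rule that; assumption)
  have hk: "(\<Sum>x\<in>{1..n}. h x) \<le> real k" using vh(4) \<tau>(4) by linarith
  have "lambda1 n a \<tau> \<le> (\<Sum>(i, j)\<in>edges n. a i j * edge_weight k V i j)"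
    by (rule lambda1_upper_bound[OF \<tau>(1,2) vh(1-3) hk vh(5) V(1) Vne V2k]) (use a in auto)
  then have "lambda1 n a \<tau> * mass \<le> (\<Sum>(i, j)\<in>edges n. a i j * edge_weight k V i j) * mass"
    using mass by (simp add: mult_right_mono)
  also have "\<dots> = (\<Sum>(i, j)\<in>edges n. a i j * (edge_weight k V i j * mass))"
    unfolding sum_distrib_right by (auto intro!: sum.cong)
  also have "\<dots> \<le> (\<Sum>(i, j)\<in>edges n. a i j * dirichlet {1..n} g i j)"
  proof (rule sum_pair_mono)
    fix i j assume e: "(i, j) \<in> edges n"
    then have "0 \<le> a i j" using a by (auto simp: edges_def)
    then show "a i j * (edge_weight k V i j * mass) \<le> a i j * dirichlet {1..n} g i j"
      using weight edgesD[OF e] by (intro mult_left_mono) auto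
  qed
  also have "\<dots> = lambda1 n a \<sigma> * mass" unfolding mass_def by (rule g(3)[symmetric])
  finally show "lambda1 n a \<tau> \<le> lambda1 n a \<sigma>" using mass by simp
qed

text \<open>The diagrams themselves are not compared. An isomorphism would carry the test vector of
  \<open>\<tau>\<close> to a nonzero vector of \<open>\<sigma>\<close> invariant under
  transpositions of the labels with \<open>h\<close> zero, of which there are at least
  \<open>n - 2 * k\<close>; \<open>fixed_vector_eq_zero\<close> excludes this.\<close>

lemma not_isomorphic_long_row_column:
  assumes k: "k \<ge> 1" and n: "n \<ge> 4 * k\<^sup>2 + 4 * k"
    and \<tau>: "unitary_rep n \<tau>" "degree_rep \<tau> > 0" "has_young_diagram n \<tau> r" "card (first_row r) \<ge> n - k"
    and \<sigma>: "has_young_diagram n \<sigma> s" "card (first_column s) \<ge> n - k"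
  shows "\<not> isomorphic_rep n \<sigma> \<tau>"
proof
  assume "isomorphic_rep n \<sigma> \<tau>"
  then obtain P where deg: "degree_rep \<sigma> = degree_rep \<tau>" and P: "P \<in> carrier (GL (degree_rep \<sigma>))"
    and PP: "\<And>p. p permutes {1..n} \<Longrightarrow> P * \<sigma> p = \<tau> p * P"
    by (auto simp: isomorphic_rep_def sym_group_carrier)
  let ?d = "degree_rep \<tau>"
  obtain T where "specht_isomorphism n \<tau> r T" using has_young_diagram_specht_isomorphism[OF \<tau>(3)] .
  then interpret \<tau>: specht_isomorphism n \<tau> r T .
  obtain T' where "specht_isomorphism n \<sigma> s T'" using has_young_diagram_specht_isomorphism[OF \<sigma>(1)] .
  then interpret \<sigma>: specht_isomorphism n \<sigma> s T' .
  obtain v h where vh: "v \<in> carrier_vec ?d" "v \<noteq> 0\<^sub>v ?d"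
    "\<And>x. x \<in> {1..n} \<Longrightarrow> h x = 0 \<or> h x \<ge> (1/2 :: real)"
    "(\<Sum>x\<in>{1..n}. h x) \<le> real n - card (first_row r)"
    "\<And>i j. i \<in> {1..n} \<Longrightarrow> j \<in> {1..n} \<Longrightarrow> i \<noteq> j \<Longrightarrow> h j = 0 \<Longrightarrow>
      Re ((\<tau> (transpose i j) *\<^sub>v v) \<bullet>c v) = (1 - h i) * sqnorm v"
    "\<And>i j. i \<in> {1..n} \<Longrightarrow> j \<in> {1..n} \<Longrightarrow> i \<noteq> j \<Longrightarrow> h i = 0 \<Longrightarrow> h j = 0 \<Longrightarrow>
      \<tau> (transpose i j) *\<^sub>v v = v"
    by (rule \<tau>.polytabloid_vector[OF \<tau>(1,2)]) (rule that; assumption)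
  interpret G: group "GL ?d" by (rule GL_group)
  define Q where "Q = inv\<^bsub>GL ?d\<^esub> P"
  have QG: "Q \<in> carrier (GL ?d)" using P deg by (simp add: Q_def)
  have QP: "Q * P = 1\<^sub>m ?d" and PQ: "P * Q = 1\<^sub>m ?d"
    using G.l_inv[of P] G.r_inv[of P] P deg by (simp_all add: Q_def GL_mult GL_one)
  have PC: "P \<in> carrier_mat ?d ?d" and QC: "Q \<in> carrier_mat ?d ?d"
    using GL_carrier P QG deg by auto
  have Qeq: "\<sigma> p *\<^sub>v (Q *\<^sub>v v) = Q *\<^sub>v (\<tau> p *\<^sub>v v)" if p: "p permutes {1..n}" for p
  proof -
    have sC: "\<sigma> p \<in> carrier_mat ?d ?d" and tC: "\<tau> p \<in> carrier_mat ?d ?d"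
      using representation_carrier[OF \<sigma>.rep p] representation_carrier[OF \<tau>.rep p] deg by auto
    have "\<sigma> p * Q = (Q * P) * (\<sigma> p * Q)" using sC QC QP by simp
    also have "\<dots> = Q * (P * \<sigma> p) * Q"
      using sC QC PC by (simp add: assoc_mult_mat[of _ ?d ?d _ ?d _ ?d])
    also have "\<dots> = Q * \<tau> p * (P * Q)"
      unfolding PP[OF p] using tC QC PC by (simp add: assoc_mult_mat[of _ ?d ?d _ ?d _ ?d])
    also have "\<dots> = Q * \<tau> p" using PQ tC QC by simp
    finally have "\<sigma> p * Q = Q * \<tau> p" .
    then show ?thesis using sC tC QC vh(1) by (metis assoc_mult_mat_vec)
  qed
  define U where "U = {x \<in> {1..n}. h x = 0}"
  have "card ({1..n} - U) * (1/2) \<le> (\<Sum>x\<in>{1..n} - U. h x)"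
    using vh(3) sum_bounded_below[of "{1..n} - U" "1/2" h] by (force simp: U_def)
  also have "\<dots> = (\<Sum>x\<in>{1..n}. h x)" by (rule sum.mono_neutral_left) (auto simp: U_def)
  also have "\<dots> \<le> real k" using vh(4) \<tau>(4) by linarith
  finally have "real (card ({1..n} - U)) \<le> real (2 * k)" by simp
  then have "card ({1..n} - U) \<le> 2 * k" by linarith
  moreover have "card ({1..n} - U) = n - card U" by (subst card_Diff_subset) (auto simp: U_def)
  ultimately have cU: "card U + 2 * k \<ge> n" by simp
  have "k \<le> k\<^sup>2" using k by (simp add: power2_eq_square)
  \<comment> \<open>An overlap of two points requires
    \<open>(n - 2 * k) + (n - k) \<ge> n + 2\<close>.\<close>
  then have "n \<ge> 3 * k + 2" using n k by linarith
  then have "card U + card (first_column s) \<ge> n + 2" using cU \<sigma>(2) by linarith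
  then have "Q *\<^sub>v v = 0\<^sub>v (degree_rep \<sigma>)"
  proof (rule \<sigma>.fixed_vector_eq_zero[rotated 2])
    fix i j assume ij: "i \<in> U" "j \<in> U" "i \<noteq> j"
    then have "transpose i j permutes {1..n}" by (intro permutes_swap_id) (auto simp: U_def)
    then show "\<sigma> (transpose i j) *\<^sub>v (Q *\<^sub>v v) = Q *\<^sub>v v"
      using Qeq vh(6)[of i j] ij by (simp add: U_def)
  qed (use QC vh(1) deg in \<open>auto simp: U_def\<close>)
  then show False using GL_injective[OF QG vh(1)] vh(2) deg by simp
qed

theorem mainTheorem1:
  fixes k n :: nat and \<tau> \<sigma> :: rep and r s :: "nat list"
  assumes "k \<ge> 1" and "n \<ge> 4 * k\<^sup>2 + 4 * k"
    and "unitary_rep n \<tau>" and "irreducible_rep n \<tau>" and "has_young_diagram n \<tau> r"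
    and "card (first_row r) \<ge> n - k"
    and "unitary_rep n \<sigma>" and "irreducible_rep n \<sigma>" and "has_young_diagram n \<sigma> s"
    and "card (first_column s) \<ge> n - k"
  shows "aldous_less n \<sigma> \<tau>"
proof -
  have "degree_rep \<tau> > 0" "degree_rep \<sigma> > 0" using assms(4,8) by (auto simp: irreducible_rep_def)
  then show ?thesis unfolding aldous_less_def
    using aldous_le_long_row_column[OF assms(1-3) _ assms(5-7) _ assms(9,10)]
      not_isomorphic_long_row_column[OF assms(1-3) _ assms(5,6,9,10)] by blast
qed

end
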